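(* Let $(\mathcal C,\mathbb E,\mathfrak s)$ be an extriangulated category satisfying (WIC), with a proper class $\xi$ of $\mathbb E$-triangles having enough $\xi$-projectives and enough $\xi$-injectives. Let $\mathcal X$ be a quasi-resolving subcategory of $\mathcal C$, let $n\ge 0$ be an integer, and let $$0\to N\to X_{n-1}\to X_{n-2}\to\cdots\to X_1\to X_0\to M\to 0$$ be a $\xi$-exact complex with $X_i\in\mathcal X$ for all $0\le i\le n-1$. (In (1) and (3), $n\ge 1$.) Then the following hold. (1) There is a $\xi$-exact complex $0\to N\to X\to P_{n-2}\to\cdots\to P_1\to P_0\to M\to 0$ with $X\in\mathcal X$ and $P_i\in\mathcal P_{\mathcal X}(\xi)$ for all $0\le i\le n-2$. (2) There are a $\xi$-exact complex $0\to L\to P_{n-1}\to P_{n-2}\to\cdots\to P_1\to P_0\to M\to 0$ and an $\mathbb E$-triangle $X\to L\to N\dashrightarrow$ in $\xi$ with $X\in\mathcal X$ and $P_i\in\mathcal P_{\mathcal X}(\xi)$ for all $0\le i\le n-1$. (3) If $M\in\mathcal X$, then there is a $\xi$-exact complex $0\to N\to X\to P_{n-2}\to\cdots\to P_1\to P_0\to 0$ with $X\in\mathcal X$ and $P_i\in\mathcal P_{\mathcal X}(\xi)$ for all $0\le i\le n-2$. (4) If $M\in\mathcal X$, then there are a $\xi$-exact complex $0\to T\to P_n\to P_{n-1}\to\cdots\to P_1\to P_0\to 0$ and an $\mathbb E$-triangle $X\to T\to N\dashrightarrow$ in $\xi$ with $X\in\mathcal X$ and $P_i\in\mathcal P_{\mathcal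 X}(\xi)$ for all $0\le i\le n$. (5) Let $\mathcal H$ be a $\xi$-cogenerator of $\mathcal X$. Then for every integer $m$ with $0\le m\le n-1$ there is a $\xi$-exact complex $$0\to N\to H_{n-1}\to\cdots\to H_{m+1}\to X\to P_{m-1}\to\cdots\to P_0\to M\to 0$$ with $X\in\mathcal X$, $H_i\in\mathcal H$ for $m+1\le i\le n-1$ and $P_j\in\mathcal P_{\mathcal X}(\xi)$ for $0\le j\le m-1$. (6) Let $\mathcal H$ be a $\xi$-cogenerator of $\mathcal X$ and suppose $N\in\mathcal X$. Then for every integer $m$ with $0\le m\le n-1$ there is a $\xi$-exact complex $$0\to H_n\to H_{n-1}\to\cdots\to H_{m+1}\to X\to P_{m-1}\to\cdots\to P_0\to M\to 0$$ with $X\in\mathcal X$, $H_i\in\mathcal H$ for $m+1\le i\le n$ and $P_j\in\mathcal P_{\mathcal X}(\xi)$ for $0\le j\le m-1$.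
   Context: Extriangulated category (Nakaoka--Palu): an additive category $\mathcal C$, a biadditive functor $\mathbb E:\mathcal C^{\mathrm{op}}\times\mathcal C\to\mathbf{Ab}$, and $\mathfrak s$, as follows. For $\delta\in\mathbb E(C,A)$, $a:A\to A'$, $c:C'\to C$ put $a_*\delta=\mathbb E(C,a)(\delta)$ and $c^*\delta=\mathbb E(c,A)(\delta)$. Sequences $A\to B\to C$ and $A\to B'\to C$ are equivalent if some isomorphism $B\to B'$ commutes with the maps from $A$ and to $C$. $\mathfrak s$ assigns to each $\delta\in\mathbb E(C,A)$ an equivalence class of sequences $A\xrightarrow{x}B\xrightarrow{y}C$; a representative is written $A\xrightarrow{x}B\xrightarrow{y}C\overset{\delta}{\dashrightarrow}$ and called an $\mathbb E$-triangle ($x$ is an inflation, $y$ a deflation; $\delta$ is often omitted). Axioms, for $\mathbb E$-triangles $A\xrightarrow{x}B\xrightarrow{y}C\overset{\delta}{\dashrightarrow}$ and $A'\xrightarrow{x'}B'\xrightarrow{y'}C'\overset{\delta'}{\dashrightarrow}$: (i) if $a:A\to A'$, $c:C\to C'$ satisfy $a_*\delta=c^*\delta'$, there is $b:B\to B'$ with $bx=x'a$, $y'b=cy$; (ii) $\mathfrak s(0)=[A\to A\oplus C\to C]$ and $\mathfrak s(\delta\oplus\delta')=\mathfrak s(\delta)\oplus\mathfrak s(\delta')$; (iii) if $a:A\to A'$, $b:B\to B'$ satisfy $bx=x'a$, there is $c:C\to C'$ with $y'b=cy$ and $a_*\delta=c^*\delta'$, and dually; (iv) given $\mathbb E$-triangles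 $A\xrightarrow{f}B\xrightarrow{f'}D\overset{\delta}{\dashrightarrow}$ and $B\xrightarrow{g}C\xrightarrow{g'}F\overset{\delta'}{\dashrightarrow}$, there are $\mathbb E$-triangles $A\xrightarrow{gf}C\xrightarrow{h'}E\overset{\delta''}{\dashrightarrow}$ and $D\xrightarrow{d}E\xrightarrow{e}F\overset{f'_*\delta'}{\dashrightarrow}$ with $h'g=df'$, $eh'=g'$, $d^*\delta''=\delta$, $f_*\delta''=e^*\delta'$, and dually. (WIC): if $gf$ is an inflation so is $f$; if $gf$ is a deflation so is $g$. Proper class: a class $\xi$ of $\mathbb E$-triangles, closed under isomorphisms and finite coproducts, containing all split $\mathbb E$-triangles ($\delta=0$), closed under base change (replacing $\delta$ by $c^*\delta$) and cobase change (replacing $\delta$ by $a_*\delta$), and saturated: given $\mathbb E$-triangles $A_1\to B_1\to C\overset{\delta_1}{\dashrightarrow}$ and $A_2\to B_2\xrightarrow{y_2}C\overset{\delta_2}{\dashrightarrow}$, if the second one and the $\mathbb E$-triangle $A_1\to M\to B_2\overset{y_2^*\delta_1}{\dashrightarrow}$ lie in $\xi$, so does the first. $P$ is $\xi$-projective if $0\to\mathcal C(P,A)\to\mathcal C(P,B)\to\mathcal C(P,C)\to0$ is exact for every $\mathbb E$-triangle $A\to B\to C\dashrightarrow$ in $\xi$; $\xi$-injectives are defined dually; $\mathcal P(\xi)$ is the class of $\xi$-projectives. Enough $\xi$-projectives (injectives): every $A$ has an $\mathbb E$-triangle $K\to P\to A\dashrightarrow$ (resp. $A\to I\to K\dashrightarrow$)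 in $\xi$ with $P$ $\xi$-projective (resp. $I$ $\xi$-injective). A complex $\cdots\to X_{n+1}\to X_n\xrightarrow{d_n}X_{n-1}\to\cdots$ is $\xi$-exact if there are $\mathbb E$-triangles $K_{n+1}\xrightarrow{g_n}X_n\xrightarrow{f_n}K_n\dashrightarrow$ in $\xi$ (its $\xi$-resolution $\mathbb E$-triangles) with $d_n=g_{n-1}f_n$ for all $n$. For $0\to N\to X_{n-1}\to\cdots\to X_0\to M\to0$ this means such $\mathbb E$-triangles for $0\le i\le n-1$ with $K_0=M$, $K_n=N$ (if $n=0$, $N\cong M$); similarly for one-sided complexes. Terms whose index ranges are empty are omitted. All subcategories are full and additive. An $\mathcal X$-resolution of $M$ is a $\xi$-exact complex $\cdots\to X_1\to X_0\to M\to0$ with all $X_i\in\mathcal X$; $\mathrm{res}(\mathcal X)$ is the class of objects having one. $\mathcal P_{\mathcal X}(\xi)=\mathcal X\cap\mathcal P(\xi)$. $\mathcal X$ is quasi-resolving if for every $\mathbb E$-triangle $A\to B\to C\dashrightarrow$ in $\xi$: $A,C\in\mathcal X$ implies $B\in\mathcal X$ (closed under $\xi$-extensions) and $B,C\in\mathcal X$ implies $A\in\mathcal X$ (closed under $\xi$-cocones); and $\mathcal X\subseteq\mathrm{res}(\mathcal P_{\mathcal X}(\xi))$. A subcategory $\mathcal H\subseteq\mathcal X$ is a $\xi$-cogenerator of $\mathcal X$ if every $X\in\mathcal X$ admits an $\mathbb E$-triangle $X\to H\to X'\dashrightarrow$ in $\xi$ with $H\in\mathcal H$, $X'\in\mathcal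 X$. *)

theory Defs
  imports "HOL-Algebra.Exact_Sequence"
begin

text \<open>
  Categories are given by hom-sets indexed by source and target.  Hom-groups and extension groups
  are commutative groups of HOL-Algebra, hence written multiplicatively: \<open>\<otimes>\<close> is the sum of parallel
  morphisms (or of extensions) and \<open>\<one>\<close> is the zero morphism (the split extension), whereas
  composition of morphisms is \<open>\<cdot>\<close>.  In the record below \<open>Ext C A\<close> is the group E(C,A), \<open>push a\<close> and
  \<open>pull c\<close> are the maps written with lower star a and upper star c, and \<open>realize C A \<delta>\<close> is the
  equivalence class s(\<delta>); a sequence from A to C is coded as the triple (B, x, y) with x from A to B
  and y from B to C.
\<close>

record ('o, 'm, 'e) extri =
  Obj :: "'o set"
  Hom :: "'o \<Rightarrow> 'o \<Rightarrow> 'm monoid"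
  Id :: "'o \<Rightarrow> 'm"
  cmp :: "'m \<Rightarrow> 'm \<Rightarrow> 'm"  (infixl \<open>\<cdot>\<index>\<close> 75)
  Ext :: "'o \<Rightarrow> 'o \<Rightarrow> 'e monoid"
  push :: "'m \<Rightarrow> 'e \<Rightarrow> 'e"
  pull :: "'m \<Rightarrow> 'e \<Rightarrow> 'e"
  realize :: "'o \<Rightarrow> 'o \<Rightarrow> 'e \<Rightarrow> ('o \<times> 'm \<times> 'm) set"

text \<open>\<open>(A, x, B, y, C, \<delta>)\<close> stands for A \<open>\<rightarrow>\<close> B \<open>\<rightarrow>\<close> C with extension \<open>\<delta>\<close> in E(C,A).\<close>

type_synonym ('o, 'm, 'e) triangle = "'o \<times> 'm \<times> 'o \<times> 'm \<times> 'o \<times> 'e"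


section \<open>Additive categories\<close>

locale ex_category =
  fixes \<C> :: "('o, 'm, 'e) extri" (structure)
  assumes Id_closed: "A \<in> Obj \<C> \<Longrightarrow> Id \<C> A \<in> carrier (Hom \<C> A A)"
    and cmp_closed:
      "\<lbrakk>A \<in> Obj \<C>; B \<in> Obj \<C>; C \<in> Obj \<C>; f \<in> carrier (Hom \<C> A B); g \<in> carrier (Hom \<C> B C)\<rbrakk>
        \<Longrightarrow> g \<cdot> f \<in> carrier (Hom \<C> A C)"
    and cmp_Id_right: "\<lbrakk>A \<in> Obj \<C>; B \<in> Obj \<C>; f \<in> carrier (Hom \<C> A B)\<rbrakk> \<Longrightarrow> f \<cdot> Id \<C> A = f"
    and cmp_Id_left: "\<lbrakk>A \<in> Obj \<C>; B \<in> Obj \<C>; f \<in> carrier (Hom \<C> A B)\<rbrakk> \<Longrightarrow> Id \<C> B \<cdot> f = f"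
    and cmp_assoc:
      "\<lbrakk>A \<in> Obj \<C>; B \<in> Obj \<C>; C \<in> Obj \<C>; D \<in> Obj \<C>;
        f \<in> carrier (Hom \<C> A B); g \<in> carrier (Hom \<C> B C); h \<in> carrier (Hom \<C> C D)\<rbrakk>
        \<Longrightarrow> h \<cdot> g \<cdot> f = h \<cdot> (g \<cdot> f)"

definition is_iso :: "('o, 'm, 'e) extri \<Rightarrow> 'o \<Rightarrow> 'o \<Rightarrow> 'm \<Rightarrow> bool" where
  "is_iso \<C> A B f \<longleftrightarrow> A \<in> Obj \<C> \<and> B \<in> Obj \<C> \<and> f \<in> carrier (Hom \<C> A B) \<and>
    (\<exists>g \<in> carrier (Hom \<C> B A). g \<cdot>\<^bsub>\<C>\<^esub> f = Id \<C> A \<and> f \<cdot>\<^bsub>\<C>\<^esub> g = Id \<C> B)"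

definition is_zero_object :: "('o, 'm, 'e) extri \<Rightarrow> 'o \<Rightarrow> bool" where
  "is_zero_object \<C> Z \<longleftrightarrow> Z \<in> Obj \<C> \<and>
    (\<forall>A \<in> Obj \<C>. (\<exists>!f. f \<in> carrier (Hom \<C> A Z)) \<and> (\<exists>!f. f \<in> carrier (Hom \<C> Z A)))"

text \<open>S is a biproduct of A and B with injections i, j and projections p, q.\<close>

definition is_biproduct ::
  "('o, 'm, 'e) extri \<Rightarrow> 'o \<Rightarrow> 'o \<Rightarrow> 'o \<Rightarrow> 'm \<Rightarrow> 'm \<Rightarrow> 'm \<Rightarrow> 'm \<Rightarrow> bool" where
  "is_biproduct \<C> A B S i j p q \<longleftrightarrow> A \<in> Obj \<C> \<and> B \<in> Obj \<C> \<and> S \<in> Obj \<C> \<and>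
    i \<in> carrier (Hom \<C> A S) \<and> j \<in> carrier (Hom \<C> B S) \<and>
    p \<in> carrier (Hom \<C> S A) \<and> q \<in> carrier (Hom \<C> S B) \<and>
    p \<cdot>\<^bsub>\<C>\<^esub> i = Id \<C> A \<and> q \<cdot>\<^bsub>\<C>\<^esub> j = Id \<C> B \<and>
    p \<cdot>\<^bsub>\<C>\<^esub> j = \<one>\<^bsub>Hom \<C> B A\<^esub> \<and> q \<cdot>\<^bsub>\<C>\<^esub> i = \<one>\<^bsub>Hom \<C> A B\<^esub> \<and>
    (i \<cdot>\<^bsub>\<C>\<^esub> p) \<otimes>\<^bsub>Hom \<C> S S\<^esub> (j \<cdot>\<^bsub>\<C>\<^esub> q) = Id \<C> S"

locale additive_category = ex_category +
  assumes Hom_group: "\<lbrakk>A \<in> Obj \<C>; B \<in> Obj \<C>\<rbrakk> \<Longrightarrow> comm_group (Hom \<C> A B)"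
    and cmp_add_right:
      "\<lbrakk>A \<in> Obj \<C>; B \<in> Obj \<C>; C \<in> Obj \<C>; g \<in> carrier (Hom \<C> B C)\<rbrakk>
        \<Longrightarrow> (\<lambda>f. g \<cdot> f) \<in> hom (Hom \<C> A B) (Hom \<C> A C)"
    and cmp_add_left:
      "\<lbrakk>A \<in> Obj \<C>; B \<in> Obj \<C>; C \<in> Obj \<C>; f \<in> carrier (Hom \<C> A B)\<rbrakk>
        \<Longrightarrow> (\<lambda>g. g \<cdot> f) \<in> hom (Hom \<C> B C) (Hom \<C> A C)"
    and zero_object_exists: "\<exists>Z. is_zero_object \<C> Z"
    and biproduct_exists:
      "\<lbrakk>A \<in> Obj \<C>; B \<in> Obj \<C>\<rbrakk> \<Longrightarrow> \<exists>S i j p q. is_biproduct \<C> A B S i j p q"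


section \<open>Extriangulated categories\<close>

locale ext_bifunctor = additive_category +
  assumes Ext_group: "\<lbrakk>A \<in> Obj \<C>; C \<in> Obj \<C>\<rbrakk> \<Longrightarrow> comm_group (Ext \<C> C A)"
    and push_hom:
      "\<lbrakk>A \<in> Obj \<C>; A' \<in> Obj \<C>; C \<in> Obj \<C>; a \<in> carrier (Hom \<C> A A')\<rbrakk>
        \<Longrightarrow> push \<C> a \<in> hom (Ext \<C> C A) (Ext \<C> C A')"
    and pull_hom:
      "\<lbrakk>A \<in> Obj \<C>; C \<in> Obj \<C>; C' \<in> Obj \<C>; c \<in> carrier (Hom \<C> C' C)\<rbrakk>
        \<Longrightarrow> pull \<C> c \<in> hom (Ext \<C> C A) (Ext \<C> C' A)"
    and push_Id: "\<lbrakk>A \<in> Obj \<C>; C \<in> Obj \<C>; \<delta> \<in> carrier (Ext \<C> C A)\<rbrakk> \<Longrightarrow> push \<C> (Id \<C> A) \<delta> = \<delta>"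
    and pull_Id: "\<lbrakk>A \<in> Obj \<C>; C \<in> Obj \<C>; \<delta> \<in> carrier (Ext \<C> C A)\<rbrakk> \<Longrightarrow> pull \<C> (Id \<C> C) \<delta> = \<delta>"
    and push_cmp:
      "\<lbrakk>A \<in> Obj \<C>; A' \<in> Obj \<C>; A'' \<in> Obj \<C>; C \<in> Obj \<C>; a \<in> carrier (Hom \<C> A A');
        a' \<in> carrier (Hom \<C> A' A''); \<delta> \<in> carrier (Ext \<C> C A)\<rbrakk>
        \<Longrightarrow> push \<C> (a' \<cdot> a) \<delta> = push \<C> a' (push \<C> a \<delta>)"
    and pull_cmp:
      "\<lbrakk>A \<in> Obj \<C>; C \<in> Obj \<C>; C' \<in> Obj \<C>; C'' \<in> Obj \<C>; c \<in> carrier (Hom \<C> C' C);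
        c' \<in> carrier (Hom \<C> C'' C'); \<delta> \<in> carrier (Ext \<C> C A)\<rbrakk>
        \<Longrightarrow> pull \<C> (c \<cdot> c') \<delta> = pull \<C> c' (pull \<C> c \<delta>)"
    and push_pull:
      "\<lbrakk>A \<in> Obj \<C>; A' \<in> Obj \<C>; C \<in> Obj \<C>; C' \<in> Obj \<C>; a \<in> carrier (Hom \<C> A A');
        c \<in> carrier (Hom \<C> C' C); \<delta> \<in> carrier (Ext \<C> C A)\<rbrakk>
        \<Longrightarrow> push \<C> a (pull \<C> c \<delta>) = pull \<C> c (push \<C> a \<delta>)"
    and push_add:
      "\<lbrakk>A \<in> Obj \<C>; A' \<in> Obj \<C>; C \<in> Obj \<C>; \<delta> \<in> carrier (Ext \<C> C A)\<rbrakk>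
        \<Longrightarrow> (\<lambda>a. push \<C> a \<delta>) \<in> hom (Hom \<C> A A') (Ext \<C> C A')"
    and pull_add:
      "\<lbrakk>A \<in> Obj \<C>; C \<in> Obj \<C>; C' \<in> Obj \<C>; \<delta> \<in> carrier (Ext \<C> C A)\<rbrakk>
        \<Longrightarrow> (\<lambda>c. pull \<C> c \<delta>) \<in> hom (Hom \<C> C' C) (Ext \<C> C' A)"

definition sequences :: "('o, 'm, 'e) extri \<Rightarrow> 'o \<Rightarrow> 'o \<Rightarrow> ('o \<times> 'm \<times> 'm) set" where
  "sequences \<C> A C =
    {(B, x, y). B \<in> Obj \<C> \<and> x \<in> carrier (Hom \<C> A B) \<and> y \<in> carrier (Hom \<C> B C)}"

definition seq_equiv ::
  "('o, 'm, 'e) extri \<Rightarrow> 'o \<Rightarrow> 'o \<Rightarrow> (('o \<times> 'm \<times> 'm) \<times> ('o \<times> 'm \<times> 'm)) set" where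
  "seq_equiv \<C> A C =
    {((B, x, y), (B', x', y')). (B, x, y) \<in> sequences \<C> A C \<and> (B', x', y') \<in> sequences \<C> A C \<and>
      (\<exists>b. is_iso \<C> B B' b \<and> b \<cdot>\<^bsub>\<C>\<^esub> x = x' \<and> y' \<cdot>\<^bsub>\<C>\<^esub> b = y)}"

definition triangles :: "('o, 'm, 'e) extri \<Rightarrow> ('o, 'm, 'e) triangle set" where
  "triangles \<C> = {(A, x, B, y, C, \<delta>). A \<in> Obj \<C> \<and> C \<in> Obj \<C> \<and> \<delta> \<in> carrier (Ext \<C> C A) \<and>
     (B, x, y) \<in> realize \<C> C A \<delta>}"

text \<open>
  The third triangle is the direct sum of the first two, for some choice of the three biproducts.
  The extension \<open>\<delta> \<oplus> \<delta>'\<close> is the element of \<open>E(C \<oplus> C', A \<oplus> A')\<close> that biadditivity assigns to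
  \<open>(\<delta>, 0, 0, \<delta>')\<close>.
\<close>

definition is_triangle_sum ::
  "('o, 'm, 'e) extri \<Rightarrow> ('o, 'm, 'e) triangle \<Rightarrow> ('o, 'm, 'e) triangle \<Rightarrow> ('o, 'm, 'e) triangle
    \<Rightarrow> bool" where
  "is_triangle_sum \<C> = (\<lambda>(A, x, B, y, C, \<delta>) (A', x', B', y', C', \<delta>') (R, u, S, v, T, \<epsilon>).
    \<exists>iA jA pA qA iB jB pB qB iC jC pC qC.
      is_biproduct \<C> A A' R iA jA pA qA \<and> is_biproduct \<C> B B' S iB jB pB qB \<and>
      is_biproduct \<C> C C' T iC jC pC qC \<and>
      u = (iB \<cdot>\<^bsub>\<C>\<^esub> x \<cdot>\<^bsub>\<C>\<^esub> pA) \<otimes>\<^bsub>Hom \<C> R S\<^esub> (jB \<cdot>\<^bsub>\<C>\<^esub> x' \<cdot>\<^bsub>\<C>\<^esub> qA) \<and>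
      v = (iC \<cdot>\<^bsub>\<C>\<^esub> y \<cdot>\<^bsub>\<C>\<^esub> pB) \<otimes>\<^bsub>Hom \<C> S T\<^esub> (jC \<cdot>\<^bsub>\<C>\<^esub> y' \<cdot>\<^bsub>\<C>\<^esub> qB) \<and>
      \<epsilon> = push \<C> iA (pull \<C> pC \<delta>) \<otimes>\<^bsub>Ext \<C> T R\<^esub> push \<C> jA (pull \<C> qC \<delta>'))"

locale extriangulated_category = ext_bifunctor +
  assumes realize_class:
      "\<lbrakk>A \<in> Obj \<C>; C \<in> Obj \<C>; \<delta> \<in> carrier (Ext \<C> C A)\<rbrakk>
        \<Longrightarrow> realize \<C> C A \<delta> \<in> sequences \<C> A C // seq_equiv \<C> A C"
    and realize_morphism:
      "\<lbrakk>(A, x, B, y, C, \<delta>) \<in> triangles \<C>; (A', x', B', y', C', \<delta>') \<in> triangles \<C>;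
        a \<in> carrier (Hom \<C> A A'); c \<in> carrier (Hom \<C> C C'); push \<C> a \<delta> = pull \<C> c \<delta>'\<rbrakk>
        \<Longrightarrow> \<exists>b \<in> carrier (Hom \<C> B B'). b \<cdot> x = x' \<cdot> a \<and> y' \<cdot> b = c \<cdot> y"
    and realize_zero:
      "is_biproduct \<C> A C S i j p q \<Longrightarrow> (A, i, S, q, C, \<one>\<^bsub>Ext \<C> C A\<^esub>) \<in> triangles \<C>"
    and realize_sum:
      "\<lbrakk>t \<in> triangles \<C>; t' \<in> triangles \<C>; is_triangle_sum \<C> t t' t''\<rbrakk> \<Longrightarrow> t'' \<in> triangles \<C>"
    and ET3:
      "\<lbrakk>(A, x, B, y, C, \<delta>) \<in> triangles \<C>; (A', x', B', y', C', \<delta>') \<in> triangles \<C>;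
        a \<in> carrier (Hom \<C> A A'); b \<in> carrier (Hom \<C> B B'); b \<cdot> x = x' \<cdot> a\<rbrakk>
        \<Longrightarrow> \<exists>c \<in> carrier (Hom \<C> C C'). y' \<cdot> b = c \<cdot> y \<and> push \<C> a \<delta> = pull \<C> c \<delta>'"
    and ET3_op:
      "\<lbrakk>(A, x, B, y, C, \<delta>) \<in> triangles \<C>; (A', x', B', y', C', \<delta>') \<in> triangles \<C>;
        b \<in> carrier (Hom \<C> B B'); c \<in> carrier (Hom \<C> C C'); y' \<cdot> b = c \<cdot> y\<rbrakk>
        \<Longrightarrow> \<exists>a \<in> carrier (Hom \<C> A A'). b \<cdot> x = x' \<cdot> a \<and> push \<C> a \<delta> = pull \<C> c \<delta>'"
    and ET4:
      "\<lbrakk>(A, f, B, f', D, \<delta>) \<in> triangles \<C>; (B, g, C, g', F, \<delta>') \<in> triangles \<C>\<rbrakk>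
        \<Longrightarrow> \<exists>E h' d e \<delta>''.
              (A, g \<cdot> f, C, h', E, \<delta>'') \<in> triangles \<C> \<and>
              (D, d, E, e, F, push \<C> f' \<delta>') \<in> triangles \<C> \<and>
              h' \<cdot> g = d \<cdot> f' \<and> e \<cdot> h' = g' \<and>
              pull \<C> d \<delta>'' = \<delta> \<and> push \<C> f \<delta>'' = pull \<C> e \<delta>'"
    and ET4_op:
      "\<lbrakk>(D, f', B, f, A, \<delta>) \<in> triangles \<C>; (F, g', C, g, B, \<delta>') \<in> triangles \<C>\<rbrakk>
        \<Longrightarrow> \<exists>E h' d e \<delta>''.
              (E, h', C, f \<cdot> g, A, \<delta>'') \<in> triangles \<C> \<and>
              (F, e, E, d, D, pull \<C> f' \<delta>') \<in> triangles \<C> \<and>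
              g \<cdot> h' = f' \<cdot> d \<and> h' \<cdot> e = g' \<and>
              push \<C> d \<delta>'' = \<delta> \<and> pull \<C> f \<delta>'' = push \<C> e \<delta>'"

definition inflation :: "('o, 'm, 'e) extri \<Rightarrow> 'o \<Rightarrow> 'o \<Rightarrow> 'm \<Rightarrow> bool" where
  "inflation \<C> A B x \<longleftrightarrow> (\<exists>y C \<delta>. (A, x, B, y, C, \<delta>) \<in> triangles \<C>)"

definition deflation :: "('o, 'm, 'e) extri \<Rightarrow> 'o \<Rightarrow> 'o \<Rightarrow> 'm \<Rightarrow> bool" where
  "deflation \<C> B C y \<longleftrightarrow> (\<exists>A x \<delta>. (A, x, B, y, C, \<delta>) \<in> triangles \<C>)"

definition WIC :: "('o, 'm, 'e) extri \<Rightarrow> bool" where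
  "WIC \<C> \<longleftrightarrow>
    (\<forall>A \<in> Obj \<C>. \<forall>B \<in> Obj \<C>. \<forall>C \<in> Obj \<C>. \<forall>f \<in> carrier (Hom \<C> A B). \<forall>g \<in> carrier (Hom \<C> B C).
      (inflation \<C> A C (g \<cdot>\<^bsub>\<C>\<^esub> f) \<longrightarrow> inflation \<C> A B f) \<and>
      (deflation \<C> A C (g \<cdot>\<^bsub>\<C>\<^esub> f) \<longrightarrow> deflation \<C> B C g))"


section \<open>Proper classes\<close>

definition triangle_iso ::
  "('o, 'm, 'e) extri \<Rightarrow> ('o, 'm, 'e) triangle \<Rightarrow> ('o, 'm, 'e) triangle \<Rightarrow> bool" where
  "triangle_iso \<C> = (\<lambda>(A, x, B, y, C, \<delta>) (A', x', B', y', C', \<delta>').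
    \<exists>a b c. is_iso \<C> A A' a \<and> is_iso \<C> B B' b \<and> is_iso \<C> C C' c \<and>
      b \<cdot>\<^bsub>\<C>\<^esub> x = x' \<cdot>\<^bsub>\<C>\<^esub> a \<and> y' \<cdot>\<^bsub>\<C>\<^esub> b = c \<cdot>\<^bsub>\<C>\<^esub> y \<and> push \<C> a \<delta> = pull \<C> c \<delta>')"

text \<open>The empty coproduct, a triangle of zero objects, is covered by \<open>split_in\<close>.\<close>

locale proper_class =
  fixes \<C> :: "('o, 'm, 'e) extri" (structure)
    and \<xi> :: "('o, 'm, 'e) triangle set"
  assumes subset_triangles: "\<xi> \<subseteq> triangles \<C>"
    and iso_closed: "\<lbrakk>t \<in> \<xi>; t' \<in> triangles \<C>; triangle_iso \<C> t t'\<rbrakk> \<Longrightarrow> t' \<in> \<xi>"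
    and sum_closed: "\<lbrakk>t \<in> \<xi>; t' \<in> \<xi>; t'' \<in> triangles \<C>; is_triangle_sum \<C> t t' t''\<rbrakk> \<Longrightarrow> t'' \<in> \<xi>"
    and split_in:
      "(A, x, B, y, C, \<one>\<^bsub>Ext \<C> C A\<^esub>) \<in> triangles \<C> \<Longrightarrow> (A, x, B, y, C, \<one>\<^bsub>Ext \<C> C A\<^esub>) \<in> \<xi>"
    and base_change:
      "\<lbrakk>(A, x, B, y, C, \<delta>) \<in> \<xi>; C' \<in> Obj \<C>; c \<in> carrier (Hom \<C> C' C);
        (A, x', B', y', C', pull \<C> c \<delta>) \<in> triangles \<C>\<rbrakk>
        \<Longrightarrow> (A, x', B', y', C', pull \<C> c \<delta>) \<in> \<xi>"
    and cobase_change: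
      "\<lbrakk>(A, x, B, y, C, \<delta>) \<in> \<xi>; A' \<in> Obj \<C>; a \<in> carrier (Hom \<C> A A');
        (A', x', B', y', C, push \<C> a \<delta>) \<in> triangles \<C>\<rbrakk>
        \<Longrightarrow> (A', x', B', y', C, push \<C> a \<delta>) \<in> \<xi>"
    and saturated:
      "\<lbrakk>(A1, x1, B1, y1, C, \<delta>1) \<in> triangles \<C>; (A2, x2, B2, y2, C, \<delta>2) \<in> \<xi>;
        (A1, m, M, m', B2, pull \<C> y2 \<delta>1) \<in> \<xi>\<rbrakk>
        \<Longrightarrow> (A1, x1, B1, y1, C, \<delta>1) \<in> \<xi>"

definition xi_projectives ::
  "('o, 'm, 'e) extri \<Rightarrow> ('o, 'm, 'e) triangle set \<Rightarrow> 'o set" where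
  "xi_projectives \<C> \<xi> = {P \<in> Obj \<C>. \<forall>(A, x, B, y, C, \<delta>) \<in> \<xi>.
    short_exact_sequence (Hom \<C> P C) (Hom \<C> P B) (Hom \<C> P A) (\<lambda>h. y \<cdot>\<^bsub>\<C>\<^esub> h) (\<lambda>h. x \<cdot>\<^bsub>\<C>\<^esub> h)}"

definition xi_injectives ::
  "('o, 'm, 'e) extri \<Rightarrow> ('o, 'm, 'e) triangle set \<Rightarrow> 'o set" where
  "xi_injectives \<C> \<xi> = {I \<in> Obj \<C>. \<forall>(A, x, B, y, C, \<delta>) \<in> \<xi>.
    short_exact_sequence (Hom \<C> A I) (Hom \<C> B I) (Hom \<C> C I) (\<lambda>h. h \<cdot>\<^bsub>\<C>\<^esub> x) (\<lambda>h. h \<cdot>\<^bsub>\<C>\<^esub> y)}"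

definition enough_projectives ::
  "('o, 'm, 'e) extri \<Rightarrow> ('o, 'm, 'e) triangle set \<Rightarrow> bool" where
  "enough_projectives \<C> \<xi> \<longleftrightarrow>
    (\<forall>A \<in> Obj \<C>. \<exists>K x P y \<delta>. (K, x, P, y, A, \<delta>) \<in> \<xi> \<and> P \<in> xi_projectives \<C> \<xi>)"

definition enough_injectives ::
  "('o, 'm, 'e) extri \<Rightarrow> ('o, 'm, 'e) triangle set \<Rightarrow> bool" where
  "enough_injectives \<C> \<xi> \<longleftrightarrow>
    (\<forall>A \<in> Obj \<C>. \<exists>x I y K \<delta>. (A, x, I, y, K, \<delta>) \<in> \<xi> \<and> I \<in> xi_injectives \<C> \<xi>)"


section \<open>Exact complexes\<close>

text \<open>
  The bounded complex 0 \<open>\<rightarrow>\<close> N \<open>\<rightarrow>\<close> \<open>X\<^sub>n\<^sub>-\<^sub>1\<close> \<open>\<rightarrow>\<close> ... \<open>\<rightarrow>\<close> \<open>X\<^sub>0\<close> \<open>\<rightarrow>\<close> M \<open>\<rightarrow>\<close> 0 is coded, from left to right, by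
  its list of objects \<open>xs = [N, X\<^sub>n\<^sub>-\<^sub>1, ..., X\<^sub>0, M]\<close> and its list of morphisms
  \<open>ds ! j : xs ! j \<rightarrow> xs ! (j + 1)\<close>.  The indexing is opposite to the usual one: \<open>K j\<close>, \<open>f j\<close> and
  \<open>g j\<close> below are \<open>K\<^sub>n\<^sub>-\<^sub>j\<close>, \<open>f\<^sub>n\<^sub>-\<^sub>1\<^sub>-\<^sub>j\<close> and \<open>g\<^sub>n\<^sub>-\<^sub>1\<^sub>-\<^sub>j\<close> in descending notation.
\<close>

definition xi_exact ::
  "('o, 'm, 'e) extri \<Rightarrow> ('o, 'm, 'e) triangle set \<Rightarrow> 'o list \<Rightarrow> 'm list \<Rightarrow> bool" where
  "xi_exact \<C> \<xi> xs ds \<longleftrightarrow> (\<exists>n. length xs = n + 2 \<and> length ds = n + 1 \<and>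
    (if n = 0 then is_iso \<C> (xs ! 0) (xs ! 1) (ds ! 0)
     else \<exists>K f g \<delta>. K 0 = xs ! 0 \<and> K n = xs ! (n + 1) \<and>
       (\<forall>j<n. (K j, g j, xs ! (j + 1), f j, K (j + 1), \<delta> j) \<in> \<xi>) \<and>
       ds ! 0 = g 0 \<and> (\<forall>j. j + 1 < n \<longrightarrow> ds ! (j + 1) = g (j + 1) \<cdot>\<^bsub>\<C>\<^esub> f j) \<and> ds ! n = f (n - 1)))"

text \<open>
  The one-sided complex ... \<open>\<rightarrow>\<close> \<open>X 1\<close> \<open>\<rightarrow>\<close> \<open>X 0\<close> \<open>\<rightarrow>\<close> M \<open>\<rightarrow>\<close> 0, where \<open>d 0\<close> is the map from \<open>X 0\<close> to M and
  \<open>d (i + 1)\<close> is the map from \<open>X (i + 1)\<close> to \<open>X i\<close>.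
\<close>

definition xi_exact_left ::
  "('o, 'm, 'e) extri \<Rightarrow> ('o, 'm, 'e) triangle set \<Rightarrow> (nat \<Rightarrow> 'o) \<Rightarrow> (nat \<Rightarrow> 'm) \<Rightarrow> 'o \<Rightarrow> bool" where
  "xi_exact_left \<C> \<xi> X d M \<longleftrightarrow> (\<exists>K f g \<delta>. K 0 = M \<and>
    (\<forall>i. (K (i + 1), g i, X i, f i, K i, \<delta> i) \<in> \<xi>) \<and>
    d 0 = f 0 \<and> (\<forall>i. d (i + 1) = g i \<cdot>\<^bsub>\<C>\<^esub> f (i + 1)))"


section \<open>Subcategories\<close>

text \<open>
  A full subcategory is given by its set of objects; it is additive as a category in its own right.
  Closure under isomorphism is not required.
\<close>

definition additive_subcategory :: "('o, 'm, 'e) extri \<Rightarrow> 'o set \<Rightarrow> bool" where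
  "additive_subcategory \<C> \<X> \<longleftrightarrow> \<X> \<subseteq> Obj \<C> \<and> (\<exists>Z \<in> \<X>. is_zero_object \<C> Z) \<and>
    (\<forall>A \<in> \<X>. \<forall>B \<in> \<X>. \<exists>S \<in> \<X>. \<exists>i j p q. is_biproduct \<C> A B S i j p q)"

definition res :: "('o, 'm, 'e) extri \<Rightarrow> ('o, 'm, 'e) triangle set \<Rightarrow> 'o set \<Rightarrow> 'o set" where
  "res \<C> \<xi> \<X> = {M \<in> Obj \<C>. \<exists>X d. xi_exact_left \<C> \<xi> X d M \<and> (\<forall>i. X i \<in> \<X>)}"

definition projectives_in ::
  "('o, 'm, 'e) extri \<Rightarrow> ('o, 'm, 'e) triangle set \<Rightarrow> 'o set \<Rightarrow> 'o set" where
  "projectives_in \<C> \<xi> \<X> = \<X> \<inter> xi_projectives \<C> \<xi>"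

definition quasi_resolving ::
  "('o, 'm, 'e) extri \<Rightarrow> ('o, 'm, 'e) triangle set \<Rightarrow> 'o set \<Rightarrow> bool" where
  "quasi_resolving \<C> \<xi> \<X> \<longleftrightarrow> additive_subcategory \<C> \<X> \<and>
    (\<forall>(A, x, B, y, C, \<delta>) \<in> \<xi>.
      (A \<in> \<X> \<and> C \<in> \<X> \<longrightarrow> B \<in> \<X>) \<and> (B \<in> \<X> \<and> C \<in> \<X> \<longrightarrow> A \<in> \<X>)) \<and>
    \<X> \<subseteq> res \<C> \<xi> (projectives_in \<C> \<xi> \<X>)"

definition xi_cogenerator ::
  "('o, 'm, 'e) extri \<Rightarrow> ('o, 'm, 'e) triangle set \<Rightarrow> 'o set \<Rightarrow> 'o set \<Rightarrow> bool" where
  "xi_cogenerator \<C> \<xi> \<H> \<X> \<longleftrightarrow> additive_subcategory \<C> \<H> \<and> \<H> \<subseteq> \<X> \<and>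
    (\<forall>X \<in> \<X>. \<exists>x H y X' \<delta>. (X, x, H, y, X', \<delta>) \<in> \<xi> \<and> H \<in> \<H> \<and> X' \<in> \<X>)"

end

theory Submission
  imports Defs
begin

text \<open>
  A complex that is exact for \<open>\<xi>\<close> is a string of triangles of \<open>\<xi>\<close>, glued at the kernels K, and the
  theorem is obtained by changing this string one triangle at a time.

  Projectives enter from the right.  Let the complex end with \<open>L \<rightarrow> Y \<rightarrow> M\<close>, preceded by
  \<open>K \<rightarrow> W \<rightarrow> L\<close>.  Resolve Y by \<open>Y' \<rightarrow> P \<rightarrow> Y\<close> with P projective and Y' in the subcategory.  The composite
  \<open>P \<rightarrow> Y \<rightarrow> M\<close> is again a deflation of \<open>\<xi>\<close>, with kernel E say, and there is a triangle
  \<open>Y' \<rightarrow> E \<rightarrow> L\<close> (\<open>xi_deflation_compose\<close>).  The pullback V of E and W over L fits into \<open>Y' \<rightarrow> V \<rightarrow> W\<close>, so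
  it lies in the subcategory, and into \<open>K \<rightarrow> V \<rightarrow> E\<close> (\<open>xi_pullback\<close>).  So \<open>W \<rightarrow> Y\<close> has been replaced by
  \<open>V \<rightarrow> P\<close>, and the complex that now ends at E is shorter by one: this is the induction behind
  \<open>chain_with_projective_tail\<close>.  Objects of a cogenerator enter from the left by the dual move, with
  composites of inflations (\<open>xi_inflation_compose\<close>) and pushouts (\<open>xi_pushout\<close>); it is the induction
  behind \<open>chain_with_cogenerator_head\<close>.  A mixed complex results from making the first move on the
  right part of the complex and the second one on the left part.

  If the end M lies in the subcategory, it can be made projective too, by pulling back the last
  triangle along a projective resolution of M (\<open>chain_with_projective_end\<close>); dually for N and the
  cogenerator (\<open>chain_with_cogenerator_start\<close>).

  The pullback of two triangles with the same third term C is built from the extension of C by the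
  biproduct of their first terms whose components are the two given extensions; dividing its middle term by
  either summand gives one of the two triangles of the pullback square.  The axioms yield these
  triangles only up to isomorphism of an end term, so that triangles have to be transported along
  isomorphisms first (\<open>triangle_transport\<close>).
\<close>

section \<open>Additive categories\<close>

context additive_category
begin

lemma cmp_one_right:
  assumes "A \<in> Obj \<C>" "B \<in> Obj \<C>" "C \<in> Obj \<C>" "g \<in> carrier (Hom \<C> B C)"
  shows "g \<cdot> \<one>\<^bsub>Hom \<C> A B\<^esub> = \<one>\<^bsub>Hom \<C> A C\<^esub>"
  using hom_one[OF cmp_add_right[OF assms]] Hom_group assms by (simp add: comm_group.axioms)

lemma cmp_one_left:
  assumes "A \<in> Obj \<C>" "B \<in> Obj \<C>" "C \<in> Obj \<C>" "f \<in> carrier (Hom \<C> A B)"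
  shows "\<one>\<^bsub>Hom \<C> B C\<^esub> \<cdot> f = \<one>\<^bsub>Hom \<C> A C\<^esub>"
  using hom_one[OF cmp_add_left[OF assms]] Hom_group assms by (simp add: comm_group.axioms)

lemma cmp_mult_right:
  assumes "A \<in> Obj \<C>" "B \<in> Obj \<C>" "C \<in> Obj \<C>" "g \<in> carrier (Hom \<C> B C)"
    "f \<in> carrier (Hom \<C> A B)" "f' \<in> carrier (Hom \<C> A B)"
  shows "g \<cdot> (f \<otimes>\<^bsub>Hom \<C> A B\<^esub> f') = (g \<cdot> f) \<otimes>\<^bsub>Hom \<C> A C\<^esub> (g \<cdot> f')"
  using hom_mult[OF cmp_add_right[OF assms(1-4)]] assms by simp

lemma cmp_mult_left:
  assumes "A \<in> Obj \<C>" "B \<in> Obj \<C>" "C \<in> Obj \<C>" "f \<in> carrier (Hom \<C> A B)"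
    "g \<in> carrier (Hom \<C> B C)" "g' \<in> carrier (Hom \<C> B C)"
  shows "(g \<otimes>\<^bsub>Hom \<C> B C\<^esub> g') \<cdot> f = (g \<cdot> f) \<otimes>\<^bsub>Hom \<C> A C\<^esub> (g' \<cdot> f)"
  using hom_mult[OF cmp_add_left[OF assms(1-4)]] assms by simp

lemma cmp_inv_right:
  assumes "A \<in> Obj \<C>" "B \<in> Obj \<C>" "C \<in> Obj \<C>" "g \<in> carrier (Hom \<C> B C)"
    "f \<in> carrier (Hom \<C> A B)"
  shows "g \<cdot> (inv\<^bsub>Hom \<C> A B\<^esub> f) = inv\<^bsub>Hom \<C> A C\<^esub> (g \<cdot> f)"
proof -
  interpret group_hom "Hom \<C> A B" "Hom \<C> A C" "\<lambda>f. g \<cdot> f"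
    using cmp_add_right[OF assms(1-4)] Hom_group assms(1-3)
    by (auto simp: group_hom_def group_hom_axioms_def comm_group.axioms)
  show ?thesis using hom_inv[OF assms(5)] .
qed

lemma cmp_inv_left:
  assumes "A \<in> Obj \<C>" "B \<in> Obj \<C>" "C \<in> Obj \<C>" "f \<in> carrier (Hom \<C> A B)"
    "g \<in> carrier (Hom \<C> B C)"
  shows "(inv\<^bsub>Hom \<C> B C\<^esub> g) \<cdot> f = inv\<^bsub>Hom \<C> A C\<^esub> (g \<cdot> f)"
proof -
  interpret group_hom "Hom \<C> B C" "Hom \<C> A C" "\<lambda>g. g \<cdot> f"
    using cmp_add_left[OF assms(1-4)] Hom_group assms(1-3)
    by (auto simp: group_hom_def group_hom_axioms_def comm_group.axioms)
  show ?thesis using hom_inv[OF assms(5)] .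
qed

lemma one_arrow: "\<lbrakk>A \<in> Obj \<C>; B \<in> Obj \<C>\<rbrakk> \<Longrightarrow> \<one>\<^bsub>Hom \<C> A B\<^esub> \<in> carrier (Hom \<C> A B)"
  using Hom_group by (simp add: comm_group.axioms group.is_monoid monoid.one_closed)

lemma biproduct_swap:
  assumes "is_biproduct \<C> A B S i j p q"
  shows "is_biproduct \<C> B A S j i q p"
proof -
  have "comm_group (Hom \<C> S S)" "i \<cdot> p \<in> carrier (Hom \<C> S S)" "j \<cdot> q \<in> carrier (Hom \<C> S S)"
    using assms Hom_group cmp_closed unfolding is_biproduct_def by blast+
  then have "(j \<cdot> q) \<otimes>\<^bsub>Hom \<C> S S\<^esub> (i \<cdot> p) = (i \<cdot> p) \<otimes>\<^bsub>Hom \<C> S S\<^esub> (j \<cdot> q)"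
    by (simp add: comm_group_def comm_monoid.m_comm)
  then show ?thesis using assms unfolding is_biproduct_def by simp
qed

text \<open>
  This biproduct makes \<open>Z \<rightarrow> B \<rightarrow> B\<close> a split triangle; comparing a triangle with it turns the axioms on
  morphisms of triangles into statements on factorizations.
\<close>

lemma biproduct_with_zero:
  assumes Z: "is_zero_object \<C> Z" and B: "B \<in> Obj \<C>"
  shows "is_biproduct \<C> Z B B \<one>\<^bsub>Hom \<C> Z B\<^esub> (Id \<C> B) \<one>\<^bsub>Hom \<C> B Z\<^esub> (Id \<C> B)"
proof -
  have O: "Z \<in> Obj \<C>" using Z unfolding is_zero_object_def by simp
  note c = one_arrow[OF O B] one_arrow[OF B O] Id_closed[OF O] Id_closed[OF B]
  have "\<one>\<^bsub>Hom \<C> B Z\<^esub> \<cdot> \<one>\<^bsub>Hom \<C> Z B\<^esub> = Id \<C> Z"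
    using Z O c(3) cmp_closed[OF O B O c(1,2)] unfolding is_zero_object_def by metis
  moreover have "(\<one>\<^bsub>Hom \<C> Z B\<^esub> \<cdot> \<one>\<^bsub>Hom \<C> B Z\<^esub>) \<otimes>\<^bsub>Hom \<C> B B\<^esub> (Id \<C> B \<cdot> Id \<C> B) = Id \<C> B"
    using cmp_one_right[OF B O B c(1)] cmp_Id_left[OF B B c(4)] Hom_group[OF B B] c(4)
    by (simp add: comm_group.axioms group.is_monoid monoid.l_one)
  ultimately show ?thesis
    unfolding is_biproduct_def using O B c by (simp add: cmp_Id_left cmp_Id_right)
qed

end


section \<open>Extensions and triangles\<close>

context ext_bifunctor
begin

lemma push_closed:
  "\<lbrakk>A \<in> Obj \<C>; A' \<in> Obj \<C>; C \<in> Obj \<C>; a \<in> carrier (Hom \<C> A A'); \<delta> \<in> carrier (Ext \<C> C A)\<rbrakk>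
    \<Longrightarrow> push \<C> a \<delta> \<in> carrier (Ext \<C> C A')"
  using push_hom by (meson hom_in_carrier)

lemma pull_closed:
  "\<lbrakk>A \<in> Obj \<C>; C \<in> Obj \<C>; C' \<in> Obj \<C>; c \<in> carrier (Hom \<C> C' C); \<delta> \<in> carrier (Ext \<C> C A)\<rbrakk>
    \<Longrightarrow> pull \<C> c \<delta> \<in> carrier (Ext \<C> C' A)"
  using pull_hom by (meson hom_in_carrier)

lemma Ext_one_closed: "\<lbrakk>A \<in> Obj \<C>; C \<in> Obj \<C>\<rbrakk> \<Longrightarrow> \<one>\<^bsub>Ext \<C> C A\<^esub> \<in> carrier (Ext \<C> C A)"
  using Ext_group by (simp add: comm_group.axioms group.is_monoid monoid.one_closed)

lemma push_one_extension:
  assumes "A \<in> Obj \<C>" "A' \<in> Obj \<C>" "C \<in> Obj \<C>" "a \<in> carrier (Hom \<C> A A')"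
  shows "push \<C> a \<one>\<^bsub>Ext \<C> C A\<^esub> = \<one>\<^bsub>Ext \<C> C A'\<^esub>"
  using hom_one[OF push_hom[OF assms]] Ext_group assms by (simp add: comm_group.axioms)

lemma push_one_arrow:
  assumes "A \<in> Obj \<C>" "A' \<in> Obj \<C>" "C \<in> Obj \<C>" "\<delta> \<in> carrier (Ext \<C> C A)"
  shows "push \<C> \<one>\<^bsub>Hom \<C> A A'\<^esub> \<delta> = \<one>\<^bsub>Ext \<C> C A'\<^esub>"
  using hom_one[OF push_add[OF assms]] Ext_group Hom_group assms by (simp add: comm_group.axioms)

lemma pull_one_arrow:
  assumes "A \<in> Obj \<C>" "C \<in> Obj \<C>" "C' \<in> Obj \<C>" "\<delta> \<in> carrier (Ext \<C> C A)"
  shows "pull \<C> \<one>\<^bsub>Hom \<C> C' C\<^esub> \<delta> = \<one>\<^bsub>Ext \<C> C' A\<^esub>"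
  using hom_one[OF pull_add[OF assms]] Ext_group Hom_group assms by (simp add: comm_group.axioms)

text \<open>
  Half of the bijection \<open>E(C, A \<oplus> B) \<cong> E(C, A) \<times> E(C, B)\<close>: every pair of extensions of C comes from
  one extension by the biproduct.
\<close>

lemma push_biproduct_surj:
  assumes S: "is_biproduct \<C> A B S i j p q" and C: "C \<in> Obj \<C>"
    and \<delta>: "\<delta> \<in> carrier (Ext \<C> C A)" and \<epsilon>: "\<epsilon> \<in> carrier (Ext \<C> C B)"
  shows "\<exists>\<mu> \<in> carrier (Ext \<C> C S). push \<C> p \<mu> = \<delta> \<and> push \<C> q \<mu> = \<epsilon>"
proof
  have O: "A \<in> Obj \<C>" "B \<in> Obj \<C>" "S \<in> Obj \<C>"
    and c: "i \<in> carrier (Hom \<C> A S)" "j \<in> carrier (Hom \<C> B S)"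
      "p \<in> carrier (Hom \<C> S A)" "q \<in> carrier (Hom \<C> S B)"
    and e: "p \<cdot> i = Id \<C> A" "q \<cdot> j = Id \<C> B" "p \<cdot> j = \<one>\<^bsub>Hom \<C> B A\<^esub>" "q \<cdot> i = \<one>\<^bsub>Hom \<C> A B\<^esub>"
    using S unfolding is_biproduct_def by auto
  let ?\<mu> = "push \<C> i \<delta> \<otimes>\<^bsub>Ext \<C> C S\<^esub> push \<C> j \<epsilon>"
  have i\<delta>: "push \<C> i \<delta> \<in> carrier (Ext \<C> C S)" and j\<epsilon>: "push \<C> j \<epsilon> \<in> carrier (Ext \<C> C S)"
    using push_closed O C c \<delta> \<epsilon> by blast+
  interpret GS: comm_group "Ext \<C> C S" using Ext_group O C by simp
  interpret GA: comm_group "Ext \<C> C A" using Ext_group O C by simp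
  interpret GB: comm_group "Ext \<C> C B" using Ext_group O C by simp
  show "?\<mu> \<in> carrier (Ext \<C> C S)" using i\<delta> j\<epsilon> by simp
  have "push \<C> p ?\<mu> = push \<C> (p \<cdot> i) \<delta> \<otimes>\<^bsub>Ext \<C> C A\<^esub> push \<C> (p \<cdot> j) \<epsilon>"
    using hom_mult[OF push_hom[OF O(3,1) C c(3)] i\<delta> j\<epsilon>]
      push_cmp[OF O(1,3,1) C c(1,3) \<delta>] push_cmp[OF O(2,3,1) C c(2,3) \<epsilon>] by simp
  also have "\<dots> = \<delta>"
    using e O C \<delta> \<epsilon> by (simp add: push_Id push_one_arrow)
  finally have 1: "push \<C> p ?\<mu> = \<delta>" .
  have "push \<C> q ?\<mu> = push \<C> (q \<cdot> i) \<delta> \<otimes>\<^bsub>Ext \<C> C B\<^esub> push \<C> (q \<cdot> j) \<epsilon>"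
    using hom_mult[OF push_hom[OF O(3,2) C c(4)] i\<delta> j\<epsilon>]
      push_cmp[OF O(1,3,2) C c(1,4) \<delta>] push_cmp[OF O(2,3,2) C c(2,4) \<epsilon>] by simp
  also have "\<dots> = \<epsilon>"
    using e O C \<delta> \<epsilon> by (simp add: push_Id push_one_arrow)
  finally show "push \<C> p ?\<mu> = \<delta> \<and> push \<C> q ?\<mu> = \<epsilon>" using 1 by simp
qed

lemma pull_biproduct_surj:
  assumes S: "is_biproduct \<C> C D S i j p q" and A: "A \<in> Obj \<C>"
    and \<delta>: "\<delta> \<in> carrier (Ext \<C> C A)" and \<epsilon>: "\<epsilon> \<in> carrier (Ext \<C> D A)"
  shows "\<exists>\<mu> \<in> carrier (Ext \<C> S A). pull \<C> i \<mu> = \<delta> \<and> pull \<C> j \<mu> = \<epsilon>"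
proof
  have O: "C \<in> Obj \<C>" "D \<in> Obj \<C>" "S \<in> Obj \<C>"
    and c: "i \<in> carrier (Hom \<C> C S)" "j \<in> carrier (Hom \<C> D S)"
      "p \<in> carrier (Hom \<C> S C)" "q \<in> carrier (Hom \<C> S D)"
    and e: "p \<cdot> i = Id \<C> C" "q \<cdot> j = Id \<C> D" "p \<cdot> j = \<one>\<^bsub>Hom \<C> D C\<^esub>" "q \<cdot> i = \<one>\<^bsub>Hom \<C> C D\<^esub>"
    using S unfolding is_biproduct_def by auto
  let ?\<mu> = "pull \<C> p \<delta> \<otimes>\<^bsub>Ext \<C> S A\<^esub> pull \<C> q \<epsilon>"
  have p\<delta>: "pull \<C> p \<delta> \<in> carrier (Ext \<C> S A)" and q\<epsilon>: "pull \<C> q \<epsilon> \<in> carrier (Ext \<C> S A)"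
    using pull_closed O A c \<delta> \<epsilon> by blast+
  interpret GS: comm_group "Ext \<C> S A" using Ext_group O A by simp
  interpret GC: comm_group "Ext \<C> C A" using Ext_group O A by simp
  interpret GD: comm_group "Ext \<C> D A" using Ext_group O A by simp
  show "?\<mu> \<in> carrier (Ext \<C> S A)" using p\<delta> q\<epsilon> by simp
  have "pull \<C> i ?\<mu> = pull \<C> (p \<cdot> i) \<delta> \<otimes>\<^bsub>Ext \<C> C A\<^esub> pull \<C> (q \<cdot> i) \<epsilon>"
    using hom_mult[OF pull_hom[OF A O(3,1) c(1)] p\<delta> q\<epsilon>]
      pull_cmp[OF A O(1,3,1) c(3,1) \<delta>] pull_cmp[OF A O(2,3,1) c(4,1) \<epsilon>] by simp
  also have "\<dots> = \<delta>"
    using e O A \<delta> \<epsilon> by (simp add: pull_Id pull_one_arrow)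
  finally have 1: "pull \<C> i ?\<mu> = \<delta>" .
  have "pull \<C> j ?\<mu> = pull \<C> (p \<cdot> j) \<delta> \<otimes>\<^bsub>Ext \<C> D A\<^esub> pull \<C> (q \<cdot> j) \<epsilon>"
    using hom_mult[OF pull_hom[OF A O(3,2) c(2)] p\<delta> q\<epsilon>]
      pull_cmp[OF A O(1,3,2) c(3,2) \<delta>] pull_cmp[OF A O(2,3,2) c(4,2) \<epsilon>] by simp
  also have "\<dots> = \<epsilon>"
    using e O A \<delta> \<epsilon> by (simp add: pull_Id pull_one_arrow)
  finally show "pull \<C> i ?\<mu> = \<delta> \<and> pull \<C> j ?\<mu> = \<epsilon>" using 1 by simp
qed

end

context additive_category
begin

lemma seq_equiv_equiv:
  assumes "A \<in> Obj \<C>" "C \<in> Obj \<C>"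
  shows "equiv (sequences \<C> A C) (seq_equiv \<C> A C)"
proof (rule equivI)
  show "seq_equiv \<C> A C \<subseteq> sequences \<C> A C \<times> sequences \<C> A C"
    unfolding seq_equiv_def by auto
  show "refl_on (sequences \<C> A C) (seq_equiv \<C> A C)"
  proof (rule refl_onI)
    fix s assume s: "s \<in> sequences \<C> A C"
    obtain B x y where [simp]: "s = (B, x, y)" by (cases s)
    have b: "B \<in> Obj \<C>" "x \<in> carrier (Hom \<C> A B)" "y \<in> carrier (Hom \<C> B C)"
      using s by (auto simp: sequences_def)
    have "is_iso \<C> B B (Id \<C> B)"
      unfolding is_iso_def using b Id_closed cmp_Id_left by blast
    then show "(s, s) \<in> seq_equiv \<C> A C"
      using s b assms cmp_Id_left cmp_Id_right unfolding seq_equiv_def by auto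
  qed
  show "sym (seq_equiv \<C> A C)"
  proof (rule symI)
    fix s t assume st: "(s, t) \<in> seq_equiv \<C> A C"
    obtain B x y where [simp]: "s = (B, x, y)" by (cases s)
    obtain B' x' y' where [simp]: "t = (B', x', y')" by (cases t)
    obtain b b' where S: "(B, x, y) \<in> sequences \<C> A C" "(B', x', y') \<in> sequences \<C> A C"
      and b: "b \<in> carrier (Hom \<C> B B')" "b \<cdot> x = x'" "y' \<cdot> b = y"
      and b': "b' \<in> carrier (Hom \<C> B' B)" "b' \<cdot> b = Id \<C> B" "b \<cdot> b' = Id \<C> B'"
      using st by (auto simp: seq_equiv_def is_iso_def)
    have O: "B \<in> Obj \<C>" "x \<in> carrier (Hom \<C> A B)" "y \<in> carrier (Hom \<C> B C)"
       "B' \<in> Obj \<C>" "x' \<in> carrier (Hom \<C> A B')" "y' \<in> carrier (Hom \<C> B' C)"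
      using S by (auto simp: sequences_def)
    have "b' \<cdot> x' = x"
      using cmp_assoc[OF assms(1) O(1,4,1,2) b(1) b'(1)] b b' cmp_Id_left assms O by simp
    moreover have "y \<cdot> b' = y'"
      using cmp_assoc[OF O(4,1,4) assms(2) b'(1) b(1) O(6)] b b' cmp_Id_right assms O by simp
    ultimately show "(t, s) \<in> seq_equiv \<C> A C"
      using S O b b' by (auto simp: seq_equiv_def is_iso_def intro!: exI[of _ b'])
  qed
  show "trans (seq_equiv \<C> A C)"
  proof (rule transI)
    fix s t u assume st: "(s, t) \<in> seq_equiv \<C> A C" and tu: "(t, u) \<in> seq_equiv \<C> A C"
    obtain B x y where [simp]: "s = (B, x, y)" by (cases s)
    obtain B' x' y' where [simp]: "t = (B', x', y')" by (cases t)
    obtain B'' x'' y'' where [simp]: "u = (B'', x'', y'')" by (cases u)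
    obtain b b' where S: "(B, x, y) \<in> sequences \<C> A C" "(B', x', y') \<in> sequences \<C> A C"
      and b: "b \<in> carrier (Hom \<C> B B')" "b \<cdot> x = x'" "y' \<cdot> b = y"
      and b': "b' \<in> carrier (Hom \<C> B' B)" "b' \<cdot> b = Id \<C> B" "b \<cdot> b' = Id \<C> B'"
      using st by (auto simp: seq_equiv_def is_iso_def)
    obtain d d' where S': "(B'', x'', y'') \<in> sequences \<C> A C"
      and d: "d \<in> carrier (Hom \<C> B' B'')" "d \<cdot> x' = x''" "y'' \<cdot> d = y'"
      and d': "d' \<in> carrier (Hom \<C> B'' B')" "d' \<cdot> d = Id \<C> B'" "d \<cdot> d' = Id \<C> B''"
      using tu by (auto simp: seq_equiv_def is_iso_def)
    have O: "B \<in> Obj \<C>" "x \<in> carrier (Hom \<C> A B)" "y \<in> carrier (Hom \<C> B C)"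
       "B' \<in> Obj \<C>" "x' \<in> carrier (Hom \<C> A B')" "y' \<in> carrier (Hom \<C> B' C)"
       "B'' \<in> Obj \<C>" "x'' \<in> carrier (Hom \<C> A B'')" "y'' \<in> carrier (Hom \<C> B'' C)"
      using S S' by (auto simp: sequences_def)
    have db: "d \<cdot> b \<in> carrier (Hom \<C> B B'')" and b'd': "b' \<cdot> d' \<in> carrier (Hom \<C> B'' B)"
      using cmp_closed O b d b' d' by blast+
    have "b' \<cdot> d' \<cdot> (d \<cdot> b) = b' \<cdot> (d' \<cdot> d) \<cdot> b"
      using cmp_assoc[OF O(1,4,7,1) b(1) d(1) b'd'] cmp_assoc[OF O(4,7,4,1) d(1) d'(1) b'(1)] by simp
    also have "\<dots> = Id \<C> B" using b' d' cmp_Id_right O by simp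
    finally have 1: "b' \<cdot> d' \<cdot> (d \<cdot> b) = Id \<C> B" .
    have "d \<cdot> b \<cdot> (b' \<cdot> d') = d \<cdot> (b \<cdot> b') \<cdot> d'"
      using cmp_assoc[OF O(7,4,1,7) d'(1) b'(1) db] cmp_assoc[OF O(4,1,4,7) b'(1) b(1) d(1)] by simp
    also have "\<dots> = Id \<C> B''" using b' d' d cmp_Id_right O by simp
    finally have 2: "d \<cdot> b \<cdot> (b' \<cdot> d') = Id \<C> B''" .
    have "d \<cdot> b \<cdot> x = x''"
      using cmp_assoc[OF assms(1) O(1,4,7,2) b(1) d(1)] b d by simp
    moreover have "y'' \<cdot> (d \<cdot> b) = y"
      using cmp_assoc[OF O(1,4,7) assms(2) b(1) d(1) O(9)] b d by simp
    ultimately show "(s, u) \<in> seq_equiv \<C> A C"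
      using S S' O 1 2 db b'd' by (auto simp: seq_equiv_def is_iso_def intro!: exI[of _ "d \<cdot> b"])
  qed
qed

end


context extriangulated_category
begin

lemma realize_triangle_class:
  assumes "A \<in> Obj \<C>" "C \<in> Obj \<C>" "\<delta> \<in> carrier (Ext \<C> C A)"
  shows "realize \<C> C A \<delta> \<subseteq> sequences \<C> A C"
    and "realize \<C> C A \<delta> \<noteq> {}"
    and "\<lbrakk>s \<in> realize \<C> C A \<delta>; t \<in> realize \<C> C A \<delta>\<rbrakk> \<Longrightarrow> (s, t) \<in> seq_equiv \<C> A C"
    and "\<lbrakk>s \<in> realize \<C> C A \<delta>; (s, t) \<in> seq_equiv \<C> A C\<rbrakk> \<Longrightarrow> t \<in> realize \<C> C A \<delta>"
  using in_quotient_imp_subset[OF seq_equiv_equiv realize_class, OF assms(1,2) assms]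
    in_quotient_imp_non_empty[OF seq_equiv_equiv realize_class, OF assms(1,2) assms]
    in_quotient_imp_in_rel[OF seq_equiv_equiv realize_class, OF assms(1,2) assms, of s t]
    in_quotient_imp_closed[OF seq_equiv_equiv realize_class, OF assms(1,2) assms, of s t]
  by blast+

lemma triangle_closed:
  assumes "(A, x, B, y, C, \<delta>) \<in> triangles \<C>"
  shows "A \<in> Obj \<C>" "B \<in> Obj \<C>" "C \<in> Obj \<C>" "x \<in> carrier (Hom \<C> A B)"
    "y \<in> carrier (Hom \<C> B C)" "\<delta> \<in> carrier (Ext \<C> C A)"
proof -
  have t: "A \<in> Obj \<C>" "C \<in> Obj \<C>" "\<delta> \<in> carrier (Ext \<C> C A)" "(B, x, y) \<in> realize \<C> C A \<delta>"
    using assms by (auto simp: triangles_def)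
  then show "A \<in> Obj \<C>" "C \<in> Obj \<C>" "\<delta> \<in> carrier (Ext \<C> C A)" by simp_all
  show "B \<in> Obj \<C>" "x \<in> carrier (Hom \<C> A B)" "y \<in> carrier (Hom \<C> B C)"
    using realize_triangle_class(1)[OF t(1-3)] t(4) by (auto simp: sequences_def)
qed

lemma triangle_exists:
  assumes "A \<in> Obj \<C>" "C \<in> Obj \<C>" "\<delta> \<in> carrier (Ext \<C> C A)"
  shows "\<exists>x B y. (A, x, B, y, C, \<delta>) \<in> triangles \<C>"
  using realize_triangle_class(2)[OF assms] assms by (auto simp: triangles_def)

lemma triangle_middle_iso:
  assumes t: "(A, x, B, y, C, \<delta>) \<in> triangles \<C>" and t': "(A, x', B', y', C, \<delta>) \<in> triangles \<C>"
  obtains b b' where "b \<in> carrier (Hom \<C> B B')" "b' \<in> carrier (Hom \<C> B' B)"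
    "b' \<cdot> b = Id \<C> B" "b \<cdot> b' = Id \<C> B'" "b \<cdot> x = x'" "y' \<cdot> b = y"
proof -
  have "((B, x, y), (B', x', y')) \<in> seq_equiv \<C> A C"
    using realize_triangle_class(3)[OF triangle_closed(1,3,6)[OF t]] t t'
    by (auto simp: triangles_def)
  then show thesis using that by (auto simp: seq_equiv_def is_iso_def)
qed

text \<open>
  Compare with the split triangle \<open>0 \<rightarrow> D \<rightarrow> D\<close>: as u vanishes on x, it is the middle component of a morphism
  of triangles, whose third component is the factorization.
\<close>

lemma factor_through_deflation:
  assumes t: "(A, x, B, y, C, \<delta>) \<in> triangles \<C>" and D: "D \<in> Obj \<C>"
    and u: "u \<in> carrier (Hom \<C> B D)" "u \<cdot> x = \<one>\<^bsub>Hom \<C> A D\<^esub>"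
  shows "\<exists>v \<in> carrier (Hom \<C> C D). u = v \<cdot> y"
proof -
  obtain Z where Z: "is_zero_object \<C> Z" using zero_object_exists by blast
  then have ZO: "Z \<in> Obj \<C>" unfolding is_zero_object_def by simp
  note c = triangle_closed[OF t]
  have "u \<cdot> x = \<one>\<^bsub>Hom \<C> Z D\<^esub> \<cdot> \<one>\<^bsub>Hom \<C> A Z\<^esub>"
    using u cmp_one_left[OF c(1) ZO D one_arrow[OF c(1) ZO]] by simp
  then obtain v where "v \<in> carrier (Hom \<C> C D)" "Id \<C> D \<cdot> u = v \<cdot> y"
    using ET3[OF t realize_zero[OF biproduct_with_zero[OF Z D]] one_arrow[OF c(1) ZO] u(1)] by blast
  then show ?thesis using cmp_Id_left[OF c(2) D u(1)] by auto
qed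

text \<open>Map the split triangle \<open>0 \<rightarrow> B \<rightarrow> B\<close> to the given one by the identity of B: the extension pulled back
  to B is then the pushout of a split one.\<close>

lemma pull_deflation_splits:
  assumes t: "(A, x, B, y, C, \<delta>) \<in> triangles \<C>"
  shows "pull \<C> y \<delta> = \<one>\<^bsub>Ext \<C> B A\<^esub>"
proof -
  obtain Z where Z: "is_zero_object \<C> Z" using zero_object_exists by blast
  then have ZO: "Z \<in> Obj \<C>" unfolding is_zero_object_def by simp
  note c = triangle_closed[OF t]
  obtain a where "a \<in> carrier (Hom \<C> Z A)" "push \<C> a \<one>\<^bsub>Ext \<C> B Z\<^esub> = pull \<C> y \<delta>"
    using ET3_op[OF realize_zero[OF biproduct_with_zero[OF Z c(2)]] t Id_closed[OF c(2)] c(5)] by blast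
  then show ?thesis using push_one_extension[OF ZO c(1,2)] by simp
qed

text \<open>
  Write \<open>e = 1 + u\<close>.  As u vanishes on x it factors as \<open>u = v \<cdot> y\<close>, and \<open>y \<cdot> u = 0\<close>, so u squares to
  zero and \<open>1 - u\<close> is the inverse.
\<close>

lemma triangle_endomorphism_iso:
  assumes t: "(A, x, B, y, C, \<delta>) \<in> triangles \<C>" and e: "e \<in> carrier (Hom \<C> B B)"
    and ex: "e \<cdot> x = x" and ye: "y \<cdot> e = y"
  shows "is_iso \<C> B B e"
proof -
  note c = triangle_closed[OF t]
  note I = Id_closed[OF c(2)]
  interpret G: comm_group "Hom \<C> B B" using Hom_group c by simp
  interpret GA: comm_group "Hom \<C> A B" using Hom_group c by simp
  interpret GC: comm_group "Hom \<C> B C" using Hom_group c by simp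
  define u where "u = e \<otimes>\<^bsub>Hom \<C> B B\<^esub> (inv\<^bsub>Hom \<C> B B\<^esub> (Id \<C> B))"
  have u: "u \<in> carrier (Hom \<C> B B)" unfolding u_def using e I by simp
  have eu: "e = u \<otimes>\<^bsub>Hom \<C> B B\<^esub> Id \<C> B"
    unfolding u_def using e I by (simp add: G.m_assoc)
  have "u \<cdot> x = \<one>\<^bsub>Hom \<C> A B\<^esub>"
    unfolding u_def using e I c ex by (simp add: cmp_mult_left cmp_inv_left cmp_Id_left)
  then obtain v where v: "v \<in> carrier (Hom \<C> C B)" "u = v \<cdot> y"
    using factor_through_deflation[OF t c(2) u] by blast
  have "y \<cdot> u = \<one>\<^bsub>Hom \<C> B C\<^esub>"
    unfolding u_def using e I c ye by (simp add: cmp_mult_right cmp_inv_right cmp_Id_right)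
  then have uu: "u \<cdot> u = \<one>\<^bsub>Hom \<C> B B\<^esub>"
    using cmp_assoc[OF c(2,2,3,2) u c(5) v(1)] v cmp_one_right[OF c(2,3,2) v(1)] by simp
  define w where "w = Id \<C> B \<otimes>\<^bsub>Hom \<C> B B\<^esub> (inv\<^bsub>Hom \<C> B B\<^esub> u)"
  have w: "w \<in> carrier (Hom \<C> B B)" unfolding w_def using u I by simp
  have e_min_u: "e \<otimes>\<^bsub>Hom \<C> B B\<^esub> (inv\<^bsub>Hom \<C> B B\<^esub> u) = Id \<C> B"
    unfolding eu using u I by (simp add: G.m_comm[of u] G.m_assoc)
  have "e \<cdot> u = u" unfolding eu using u I c uu by (simp add: cmp_mult_left cmp_Id_left)
  then have "e \<cdot> w = e \<otimes>\<^bsub>Hom \<C> B B\<^esub> (inv\<^bsub>Hom \<C> B B\<^esub> u)"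
    unfolding w_def using u I e c by (simp add: cmp_mult_right cmp_inv_right cmp_Id_right)
  then have ew: "e \<cdot> w = Id \<C> B" using e_min_u by simp
  have "u \<cdot> e = u" unfolding eu using u I c uu by (simp add: cmp_mult_right cmp_Id_right)
  then have "w \<cdot> e = e \<otimes>\<^bsub>Hom \<C> B B\<^esub> (inv\<^bsub>Hom \<C> B B\<^esub> u)"
    unfolding w_def using u I e c by (simp add: cmp_mult_left cmp_inv_left cmp_Id_left)
  then have we: "w \<cdot> e = Id \<C> B" using e_min_u by simp
  show ?thesis unfolding is_iso_def using c e w ew we by blast
qed

lemma iso_of_two_sided:
  assumes O: "A \<in> Obj \<C>" "B \<in> Obj \<C>" and f: "f \<in> carrier (Hom \<C> A B)" and g: "g \<in> carrier (Hom \<C> B A)"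
    and gf: "is_iso \<C> A A (g \<cdot> f)" and fg: "is_iso \<C> B B (f \<cdot> g)"
  shows "is_iso \<C> A B f"
proof -
  obtain l where l: "l \<in> carrier (Hom \<C> A A)" "l \<cdot> (g \<cdot> f) = Id \<C> A"
    using gf unfolding is_iso_def by blast
  obtain r where r: "r \<in> carrier (Hom \<C> B B)" "f \<cdot> g \<cdot> r = Id \<C> B"
    using fg unfolding is_iso_def by blast
  have lg: "l \<cdot> g \<in> carrier (Hom \<C> B A)" and gr: "g \<cdot> r \<in> carrier (Hom \<C> B A)"
    using cmp_closed O l r g by blast+
  have 1: "l \<cdot> g \<cdot> f = Id \<C> A" using cmp_assoc[OF O(1,2,1,1) f g l(1)] l by simp
  have 2: "f \<cdot> (g \<cdot> r) = Id \<C> B" using cmp_assoc[OF O(2,2,1,2) r(1) g f] r by simp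
  have "l \<cdot> g = g \<cdot> r"
    using cmp_assoc[OF O(2,1,2,1) gr f lg] 1 2 cmp_Id_left[OF O(2,1) gr] cmp_Id_right[OF O(2,1) lg]
    by simp
  then show ?thesis unfolding is_iso_def using O f gr 1 2 by auto
qed

text \<open>
  A realization of the transported
  extension is linked to the given sequence by morphisms of triangles in both directions, and their
  composites are isomorphisms by \<open>triangle_endomorphism_iso\<close>.
\<close>

lemma triangle_transport:
  assumes t: "(A, x, B, y, C, \<delta>) \<in> triangles \<C>"
    and O: "A' \<in> Obj \<C>" "C' \<in> Obj \<C>"
    and a: "a \<in> carrier (Hom \<C> A A')" "a' \<in> carrier (Hom \<C> A' A)" "a' \<cdot> a = Id \<C> A" "a \<cdot> a' = Id \<C> A'"
    and c: "c \<in> carrier (Hom \<C> C C')" "c' \<in> carrier (Hom \<C> C' C)" "c' \<cdot> c = Id \<C> C" "c \<cdot> c' = Id \<C> C'"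
  shows "(A', x \<cdot> a', B, c \<cdot> y, C', push \<C> a (pull \<C> c' \<delta>)) \<in> triangles \<C>"
proof -
  note T = triangle_closed[OF t]
  let ?\<epsilon> = "push \<C> a (pull \<C> c' \<delta>)"
  have p: "pull \<C> c' \<delta> \<in> carrier (Ext \<C> C' A)" using pull_closed T O c by blast
  then have \<epsilon>: "?\<epsilon> \<in> carrier (Ext \<C> C' A')" using push_closed T O a by blast
  obtain x' B' y' where t': "(A', x', B', y', C', ?\<epsilon>) \<in> triangles \<C>"
    using triangle_exists[OF O \<epsilon>] by blast
  note T' = triangle_closed[OF t']
  have "pull \<C> c ?\<epsilon> = push \<C> a (pull \<C> c (pull \<C> c' \<delta>))"
    using push_pull[OF T(1) O T(3) a(1) c(1) p] by simp
  also have "\<dots> = push \<C> a \<delta>"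
    using pull_cmp[OF T(1,3) O(2) T(3) c(2,1) T(6)] c pull_Id T by simp
  finally obtain b where b: "b \<in> carrier (Hom \<C> B B')" "b \<cdot> x = x' \<cdot> a" "y' \<cdot> b = c \<cdot> y"
    using realize_morphism[OF t t' a(1) c(1)] by auto
  have "push \<C> a' ?\<epsilon> = pull \<C> c' \<delta>"
    using push_cmp[OF T(1) O(1) T(1) O(2) a(1,2) p] a push_Id[OF T(1) O(2) p] by simp
  then obtain b' where b': "b' \<in> carrier (Hom \<C> B' B)" "b' \<cdot> x' = x \<cdot> a'" "y \<cdot> b' = c' \<cdot> y'"
    using realize_morphism[OF t' t a(2) c(2)] by auto
  have "b' \<cdot> b \<cdot> x = b' \<cdot> x' \<cdot> a"
    using cmp_assoc[OF T(1,2) T'(2) T(2) T(4) b(1) b'(1)]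
      cmp_assoc[OF T(1) T'(1,2) T(2) a(1) T'(4) b'(1)] b by simp
  also have "\<dots> = x"
    using b' cmp_assoc[OF T(1) O(1) T(1,2) a(1,2) T(4)] a cmp_Id_right[OF T(1,2,4)] by simp
  finally have 1: "b' \<cdot> b \<cdot> x = x" .
  have "y \<cdot> (b' \<cdot> b) = c' \<cdot> (y' \<cdot> b)"
    using cmp_assoc[OF T(2) T'(2) T(2,3) b(1) b'(1) T(5)]
      cmp_assoc[OF T(2) T'(2,3) T(3) b(1) T'(5) c(2)] b' by simp
  also have "\<dots> = y"
    using b cmp_assoc[OF T(2,3) O(2) T(3) T(5) c(1,2)] c cmp_Id_left[OF T(2,3,5)] by simp
  finally have b'b: "is_iso \<C> B B (b' \<cdot> b)"
    using triangle_endomorphism_iso[OF t _ 1] cmp_closed T(2) T'(2) b(1) b'(1) by blast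
  have "b \<cdot> b' \<cdot> x' = b \<cdot> x \<cdot> a'"
    using cmp_assoc[OF T'(1,2) T(2) T'(2) T'(4) b'(1) b(1)]
      cmp_assoc[OF T'(1) T(1,2) T'(2) a(2) T(4) b(1)] b' by simp
  then have 2: "b \<cdot> b' \<cdot> x' = x'"
    using b cmp_assoc[OF O(1) T(1) T'(1,2) a(2,1) T'(4)] a cmp_Id_right[OF T'(1,2,4)] by simp
  have "y' \<cdot> (b \<cdot> b') = c \<cdot> (y \<cdot> b')"
    using cmp_assoc[OF T'(2) T(2) T'(2,3) b'(1) b(1) T'(5)]
      cmp_assoc[OF T'(2) T(2,3) T'(3) b'(1) T(5) c(1)] b by simp
  also have "\<dots> = y'"
    using b' cmp_assoc[OF T'(2,3) T(3) O(2) T'(5) c(2,1)] c cmp_Id_left[OF T'(2,3,5)] by simp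
  finally have bb': "is_iso \<C> B' B' (b \<cdot> b')"
    using triangle_endomorphism_iso[OF t' _ 2] cmp_closed T(2) T'(2) b(1) b'(1) by blast
  have iso: "is_iso \<C> B B' b"
    using iso_of_two_sided[OF _ _ _ _ b'b bb'] T(2) T'(2) b(1) b'(1) by blast
  have xa: "x \<cdot> a' \<in> carrier (Hom \<C> A' B)" and cy: "c \<cdot> y \<in> carrier (Hom \<C> B C')"
    using cmp_closed T O a c by blast+
  have "b \<cdot> (x \<cdot> a') = x'"
    using cmp_assoc[OF O(1) T(1,2) T'(2) a(2) T(4) b(1)] b
      cmp_assoc[OF O(1) T(1) T'(1,2) a(2,1) T'(4)] a cmp_Id_right[OF T'(1,2,4)] by simp
  then have "((B, x \<cdot> a', c \<cdot> y), (B', x', y')) \<in> seq_equiv \<C> A' C'"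
    using iso b T T' xa cy by (auto simp: seq_equiv_def sequences_def)
  then have "((B', x', y'), (B, x \<cdot> a', c \<cdot> y)) \<in> seq_equiv \<C> A' C'"
    using seq_equiv_equiv[OF O] by (meson equivE symE)
  then show ?thesis
    using realize_triangle_class(4)[OF O \<epsilon>] t' O \<epsilon> by (auto simp: triangles_def)
qed

text \<open>
  (ET4) for the split triangle \<open>A1 \<rightarrow> S \<rightarrow> A2\<close> and for \<open>S \<rightarrow> M \<rightarrow> C\<close> yields \<open>A1 \<rightarrow> M \<rightarrow> E\<close> together with
  \<open>A2 \<rightarrow> E \<rightarrow> C\<close>, which realizes \<open>push q \<mu>\<close>.  So E is isomorphic to \<open>B2\<close>, and it remains to transport the
  first triangle to \<open>B2\<close>.
\<close>

lemma extension_by_biproduct: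
  assumes S: "is_biproduct \<C> A1 A2 S i j p q"
    and tM: "(S, s, M, k, C, \<mu>) \<in> triangles \<C>"
    and t2: "(A2, x2, B2, y2, C, push \<C> q \<mu>) \<in> triangles \<C>"
  shows "\<exists>n. (A1, s \<cdot> i, M, n, B2, pull \<C> y2 (push \<C> p \<mu>)) \<in> triangles \<C>"
proof -
  note T = triangle_closed[OF tM] and T2 = triangle_closed[OF t2]
  have A1: "A1 \<in> Obj \<C>" and i: "i \<in> carrier (Hom \<C> A1 S)" and p: "p \<in> carrier (Hom \<C> S A1)"
    and pi: "p \<cdot> i = Id \<C> A1"
    using S unfolding is_biproduct_def by auto
  obtain E h d e \<epsilon> where tE: "(A1, s \<cdot> i, M, h, E, \<epsilon>) \<in> triangles \<C>"
    and tE2: "(A2, d, E, e, C, push \<C> q \<mu>) \<in> triangles \<C>"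
    and i\<epsilon>: "push \<C> i \<epsilon> = pull \<C> e \<mu>"
    using ET4[OF realize_zero[OF S] tM] by auto
  note TE = triangle_closed[OF tE] and TE2 = triangle_closed[OF tE2]
  obtain b b' where b: "b \<in> carrier (Hom \<C> E B2)" "b' \<in> carrier (Hom \<C> B2 E)"
    "b' \<cdot> b = Id \<C> E" "b \<cdot> b' = Id \<C> B2" "b \<cdot> d = x2" "y2 \<cdot> b = e"
    using triangle_middle_iso[OF tE2 t2] by blast
  let ?\<delta> = "push \<C> p \<mu>"
  have \<delta>: "?\<delta> \<in> carrier (Ext \<C> C A1)" using push_closed T A1 p by blast
  have "\<epsilon> = push \<C> p (pull \<C> e \<mu>)"
    using push_cmp[OF A1 T(1) A1 TE(3) i p TE(6)] pi push_Id[OF A1 TE(3,6)] i\<epsilon> by simp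
  also have "\<dots> = pull \<C> b (pull \<C> y2 ?\<delta>)"
    using push_pull[OF T(1) A1 T(3) TE(3) p TE2(5) T(6)] pull_cmp[OF A1 T2(3,2) TE(3) T2(5) b(1) \<delta>] b
    by simp
  finally have "pull \<C> b' \<epsilon> = pull \<C> b' (pull \<C> b (pull \<C> y2 ?\<delta>))" by simp
  also have "\<dots> = pull \<C> y2 ?\<delta>"
    using pull_cmp[OF A1 T2(2) TE(3) T2(2) b(1,2) pull_closed[OF A1 T2(3,2,5) \<delta>]] b(4)
      pull_Id[OF A1 T2(2) pull_closed[OF A1 T2(3,2,5) \<delta>]] by simp
  finally have "push \<C> (Id \<C> A1) (pull \<C> b' \<epsilon>) = pull \<C> y2 ?\<delta>"
    using push_Id[OF A1 T2(2) pull_closed[OF A1 T2(3,2,5) \<delta>]] by simp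
  moreover have "s \<cdot> i \<cdot> Id \<C> A1 = s \<cdot> i" using cmp_Id_right TE by simp
  ultimately have "(A1, s \<cdot> i, M, b \<cdot> h, B2, pull \<C> y2 ?\<delta>) \<in> triangles \<C>"
    using triangle_transport[OF tE A1 T2(2) Id_closed[OF A1] Id_closed[OF A1] _ _ b(1-4)]
      cmp_Id_left[OF A1 A1 Id_closed[OF A1]] by simp
  then show ?thesis by blast
qed

text \<open>
  The dual argument: (ET4) in its dual form yields \<open>E \<rightarrow> M \<rightarrow> C2\<close> and \<open>A \<rightarrow> E \<rightarrow> C1\<close>, and E is isomorphic to
  \<open>B1\<close>.
\<close>

lemma extension_of_biproduct:
  assumes S: "is_biproduct \<C> C1 C2 S i j p q"
    and tM: "(A, k, M, s, S, \<mu>) \<in> triangles \<C>"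
    and t1: "(A, x1, B1, y1, C1, pull \<C> i \<mu>) \<in> triangles \<C>"
  shows "\<exists>n. (B1, n, M, q \<cdot> s, C2, push \<C> x1 (pull \<C> j \<mu>)) \<in> triangles \<C>"
proof -
  note T = triangle_closed[OF tM] and T1 = triangle_closed[OF t1]
  have C2: "C2 \<in> Obj \<C>" and j: "j \<in> carrier (Hom \<C> C2 S)" and q: "q \<in> carrier (Hom \<C> S C2)"
    and qj: "q \<cdot> j = Id \<C> C2"
    using S unfolding is_biproduct_def by auto
  obtain E h d e \<epsilon> where tE: "(E, h, M, q \<cdot> s, C2, \<epsilon>) \<in> triangles \<C>"
    and tE1: "(A, e, E, d, C1, pull \<C> i \<mu>) \<in> triangles \<C>"
    and q\<epsilon>: "pull \<C> q \<epsilon> = push \<C> e \<mu>"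
    using ET4_op[OF realize_zero[OF S] tM] by auto
  note TE = triangle_closed[OF tE] and TE1 = triangle_closed[OF tE1]
  obtain b b' where b: "b \<in> carrier (Hom \<C> E B1)" "b' \<in> carrier (Hom \<C> B1 E)"
    "b' \<cdot> b = Id \<C> E" "b \<cdot> b' = Id \<C> B1" "b \<cdot> e = x1" "y1 \<cdot> b = d"
    using triangle_middle_iso[OF tE1 t1] by blast
  let ?\<delta> = "pull \<C> j \<mu>"
  have \<delta>: "?\<delta> \<in> carrier (Ext \<C> C2 A)" using pull_closed T C2 j by blast
  have "\<epsilon> = pull \<C> j (push \<C> e \<mu>)"
    using pull_cmp[OF TE(1) C2 T(3) C2 q j TE(6)] qj pull_Id[OF TE(1) C2 TE(6)] q\<epsilon> by simp
  also have "\<dots> = push \<C> e ?\<delta>"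
    using push_pull[OF T(1) TE(1) T(3) C2 TE1(4) j T(6)] by simp
  finally have "push \<C> b \<epsilon> = push \<C> x1 ?\<delta>"
    using push_cmp[OF T(1) TE(1) T1(2) C2 TE1(4) b(1) \<delta>] b by simp
  moreover have "Id \<C> C2 \<cdot> (q \<cdot> s) = q \<cdot> s" using cmp_Id_left TE by simp
  ultimately have "(B1, h \<cdot> b', M, q \<cdot> s, C2, push \<C> x1 ?\<delta>) \<in> triangles \<C>"
    using triangle_transport[OF tE T1(2) C2 b(1-4) Id_closed[OF C2] Id_closed[OF C2]]
      cmp_Id_left[OF C2 C2 Id_closed[OF C2]] pull_Id[OF TE(1) C2 TE(6)] by simp
  then show ?thesis by blast
qed

text \<open>
  M is the middle term of the extension of C by the biproduct of \<open>A1\<close> and \<open>A2\<close> with components \<open>\<delta>1\<close> and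
  \<open>\<delta>2\<close>; it plays the part of the fibre product of \<open>B1\<close> and \<open>B2\<close> over C.
\<close>

lemma triangle_pullback:
  assumes t1: "(A1, x1, B1, y1, C, \<delta>1) \<in> triangles \<C>" and t2: "(A2, x2, B2, y2, C, \<delta>2) \<in> triangles \<C>"
  obtains M m1 n1 m2 n2 where "(A1, m1, M, n1, B2, pull \<C> y2 \<delta>1) \<in> triangles \<C>"
    "(A2, m2, M, n2, B1, pull \<C> y1 \<delta>2) \<in> triangles \<C>"
proof -
  note T1 = triangle_closed[OF t1] and T2 = triangle_closed[OF t2]
  obtain S i j p q where S: "is_biproduct \<C> A1 A2 S i j p q"
    using biproduct_exists[OF T1(1) T2(1)] by blast
  then have SO: "S \<in> Obj \<C>" unfolding is_biproduct_def by simp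
  obtain \<mu> where \<mu>: "\<mu> \<in> carrier (Ext \<C> C S)" "push \<C> p \<mu> = \<delta>1" "push \<C> q \<mu> = \<delta>2"
    using push_biproduct_surj[OF S T1(3,6) T2(6)] by blast
  obtain s M k where M: "(S, s, M, k, C, \<mu>) \<in> triangles \<C>"
    using triangle_exists[OF SO T1(3) \<mu>(1)] by blast
  show thesis
    using extension_by_biproduct[OF S M] extension_by_biproduct[OF biproduct_swap[OF S] M]
      t1 t2 \<mu> that by blast
qed

lemma triangle_pushout:
  assumes t1: "(A, x1, B1, y1, C1, \<delta>1) \<in> triangles \<C>" and t2: "(A, x2, B2, y2, C2, \<delta>2) \<in> triangles \<C>"
  obtains M m1 n1 m2 n2 where "(B1, m1, M, n1, C2, push \<C> x1 \<delta>2) \<in> triangles \<C>"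
    "(B2, m2, M, n2, C1, push \<C> x2 \<delta>1) \<in> triangles \<C>"
proof -
  note T1 = triangle_closed[OF t1] and T2 = triangle_closed[OF t2]
  obtain S i j p q where S: "is_biproduct \<C> C1 C2 S i j p q"
    using biproduct_exists[OF T1(3) T2(3)] by blast
  then have SO: "S \<in> Obj \<C>" unfolding is_biproduct_def by simp
  obtain \<mu> where \<mu>: "\<mu> \<in> carrier (Ext \<C> S A)" "pull \<C> i \<mu> = \<delta>1" "pull \<C> j \<mu> = \<delta>2"
    using pull_biproduct_surj[OF S T1(1,6) T2(6)] by blast
  obtain k M s where M: "(A, k, M, s, S, \<mu>) \<in> triangles \<C>"
    using triangle_exists[OF T1(1) SO \<mu>(1)] by blast
  show thesis
    using extension_of_biproduct[OF S M] extension_of_biproduct[OF biproduct_swap[OF S] M]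
      t1 t2 \<mu> that by blast
qed

end


section \<open>Proper classes\<close>

locale proper_extriangulated = extriangulated_category \<C> + proper_class \<C> \<xi>
  for \<C> :: "('o, 'm, 'e) extri" (structure) and \<xi> :: "('o, 'm, 'e) triangle set"
begin

lemma xi_triangle: "t \<in> \<xi> \<Longrightarrow> t \<in> triangles \<C>"
  using subset_triangles by blast

text \<open>
  Along the deflation f the composite's extension becomes a cobase change of \<open>\<delta>'\<close>, so saturation applies.
\<close>

lemma xi_deflation_compose:
  assumes t: "(D, f', B, f, A, \<delta>) \<in> \<xi>" and t': "(F, g', C, g, B, \<delta>') \<in> \<xi>"
  obtains E h e d \<epsilon> \<eta> where "(E, h, C, f \<cdot> g, A, \<epsilon>) \<in> \<xi>" "(F, e, E, d, D, \<eta>) \<in> \<xi>"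
proof -
  note T = triangle_closed[OF xi_triangle[OF t]] and T' = triangle_closed[OF xi_triangle[OF t']]
  obtain E h d e \<epsilon> where tE: "(E, h, C, f \<cdot> g, A, \<epsilon>) \<in> triangles \<C>"
    and tF: "(F, e, E, d, D, pull \<C> f' \<delta>') \<in> triangles \<C>"
    and eq: "pull \<C> f \<epsilon> = push \<C> e \<delta>'"
    using ET4_op[OF xi_triangle[OF t] xi_triangle[OF t']] by blast
  note TE = triangle_closed[OF tE] and TF = triangle_closed[OF tF]
  have "(F, e, E, d, D, pull \<C> f' \<delta>') \<in> \<xi>"
    using base_change[OF t' T(1,4) tF] .
  moreover obtain m M m' where "(E, m, M, m', B, push \<C> e \<delta>') \<in> triangles \<C>"
    using triangle_exists[OF TE(1) T(2) push_closed[OF T'(1) TE(1) T(2) TF(4) T'(6)]] by blast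
  then have "(E, m, M, m', B, pull \<C> f \<epsilon>) \<in> \<xi>"
    using cobase_change[OF t' TE(1) TF(4)] eq by simp
  then have "(E, h, C, f \<cdot> g, A, \<epsilon>) \<in> \<xi>"
    using saturated[OF tE t] by blast
  ultimately show thesis using that by blast
qed

lemma xi_projective_lift:
  assumes "P \<in> xi_projectives \<C> \<xi>" "(A, x, B, y, C, \<delta>) \<in> \<xi>" "h \<in> carrier (Hom \<C> P C)"
  shows "\<exists>k \<in> carrier (Hom \<C> P B). y \<cdot> k = h"
proof -
  have "short_exact_sequence (Hom \<C> P C) (Hom \<C> P B) (Hom \<C> P A) (\<lambda>h. y \<cdot> h) (\<lambda>h. x \<cdot> h)"
    using assms(1,2) unfolding xi_projectives_def by fast
  then have "h \<in> (\<lambda>h. y \<cdot> h) ` carrier (Hom \<C> P B)"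
    using assms(3) short_exact_sequenceD by (fastforce simp: epi_def)
  then show ?thesis by auto
qed

lemma xi_projective_kernel:
  assumes "P \<in> xi_projectives \<C> \<xi>" "(A, x, B, y, C, \<delta>) \<in> \<xi>"
    and "k \<in> carrier (Hom \<C> P B)" "y \<cdot> k = \<one>\<^bsub>Hom \<C> P C\<^esub>"
  shows "\<exists>u \<in> carrier (Hom \<C> P A). k = x \<cdot> u"
proof -
  have "short_exact_sequence (Hom \<C> P C) (Hom \<C> P B) (Hom \<C> P A) (\<lambda>h. y \<cdot> h) (\<lambda>h. x \<cdot> h)"
    using assms(1,2) unfolding xi_projectives_def by fast
  then have "exact_seq ([Hom \<C> P C, Hom \<C> P B, Hom \<C> P A], [(\<lambda>h. y \<cdot> h), (\<lambda>h. x \<cdot> h)])"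
    using short_exact_sequenceD by blast
  then have "kernel (Hom \<C> P B) (Hom \<C> P C) (\<lambda>h. y \<cdot> h) = (\<lambda>h. x \<cdot> h) ` carrier (Hom \<C> P A)"
    by simp
  then have "k \<in> (\<lambda>h. x \<cdot> h) ` carrier (Hom \<C> P A)"
    using assms(3,4) unfolding kernel_def by blast
  then show ?thesis by auto
qed

text \<open>
  A projective deflation \<open>p: P \<rightarrow> C\<close> that lifts to B splits the triangle after pullback along p, and saturation
  descends membership in \<open>\<xi>\<close> from the split triangle.  This gives membership from a property
  of y alone, which makes up for the asymmetry of saturation.
\<close>

lemma xi_triangle_if_projectives_lift:
  assumes enough: "enough_projectives \<C> \<xi>" and t: "(A, x, B, y, C, \<delta>) \<in> triangles \<C>"
    and lift: "\<And>P h. \<lbrakk>P \<in> xi_projectives \<C> \<xi>; h \<in> carrier (Hom \<C> P C)\<rbrakk>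
      \<Longrightarrow> \<exists>k \<in> carrier (Hom \<C> P B). y \<cdot> k = h"
  shows "(A, x, B, y, C, \<delta>) \<in> \<xi>"
proof -
  note T = triangle_closed[OF t]
  obtain K u P p \<epsilon> where tP: "(K, u, P, p, C, \<epsilon>) \<in> \<xi>" and P: "P \<in> xi_projectives \<C> \<xi>"
    using enough T(3) unfolding enough_projectives_def by blast
  note TP = triangle_closed[OF xi_triangle[OF tP]]
  obtain k where k: "k \<in> carrier (Hom \<C> P B)" "y \<cdot> k = p"
    using lift[OF P TP(5)] by blast
  have split: "pull \<C> p \<delta> = \<one>\<^bsub>Ext \<C> P A\<^esub>"
  proof -
    have "pull \<C> p \<delta> = pull \<C> k \<one>\<^bsub>Ext \<C> B A\<^esub>"
      using pull_cmp[OF T(1,3,2) TP(2) T(5) k(1) T(6)] k pull_deflation_splits[OF t] by simp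
    then show ?thesis
      using hom_one[OF pull_hom[OF T(1,2) TP(2) k(1)]] Ext_group T TP by (simp add: comm_group.axioms)
  qed
  obtain m M m' where "(A, m, M, m', P, \<one>\<^bsub>Ext \<C> P A\<^esub>) \<in> triangles \<C>"
    using triangle_exists[OF T(1) TP(2) Ext_one_closed[OF T(1) TP(2)]] by blast
  then have "(A, m, M, m', P, pull \<C> p \<delta>) \<in> \<xi>" using split_in split by simp
  then show ?thesis using saturated[OF t tP] by blast
qed

text \<open>
  Saturation speaks of base change, whereas the composite's extension is controlled by a cobase change,
  so the proof goes through lifting.  A map p from a projective to E is lifted in two steps: first
  \<open>e \<cdot> p\<close> is lifted along \<open>g'\<close> to c, then \<open>p - h \<cdot> c\<close>, which e kills, comes from D and so lifts along
  \<open>f'\<close> to v.  The sum of c and \<open>g \<cdot> v\<close> lifts p.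
\<close>

lemma xi_inflation_compose:
  assumes enough: "enough_projectives \<C> \<xi>"
    and t: "(A, f, B, f', D, \<delta>) \<in> \<xi>" and t': "(B, g, C, g', F, \<delta>') \<in> \<xi>"
  obtains E h d e \<epsilon> \<eta> where "(A, g \<cdot> f, C, h, E, \<epsilon>) \<in> \<xi>" "(D, d, E, e, F, \<eta>) \<in> \<xi>"
proof -
  note T = triangle_closed[OF xi_triangle[OF t]] and T' = triangle_closed[OF xi_triangle[OF t']]
  obtain E h d e \<epsilon> where tE: "(A, g \<cdot> f, C, h, E, \<epsilon>) \<in> triangles \<C>"
    and tF: "(D, d, E, e, F, push \<C> f' \<delta>') \<in> triangles \<C>"
    and hg: "h \<cdot> g = d \<cdot> f'" and eh: "e \<cdot> h = g'"
    using ET4[OF xi_triangle[OF t] xi_triangle[OF t']] by blast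
  note TE = triangle_closed[OF tE] and TF = triangle_closed[OF tF]
  have xF: "(D, d, E, e, F, push \<C> f' \<delta>') \<in> \<xi>"
    using cobase_change[OF t' T(3,5) tF] .
  have "(A, g \<cdot> f, C, h, E, \<epsilon>) \<in> \<xi>"
  proof (rule xi_triangle_if_projectives_lift[OF enough tE])
    fix P p assume P: "P \<in> xi_projectives \<C> \<xi>" and p: "p \<in> carrier (Hom \<C> P E)"
    then have PO: "P \<in> Obj \<C>" unfolding xi_projectives_def by simp
    interpret GE: comm_group "Hom \<C> P E" using Hom_group PO TE by simp
    interpret GF: comm_group "Hom \<C> P F" using Hom_group PO TF by simp
    interpret GC: comm_group "Hom \<C> P C" using Hom_group PO TE by simp
    have ep: "e \<cdot> p \<in> carrier (Hom \<C> P F)" using cmp_closed PO TE TF p by blast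
    obtain c where c: "c \<in> carrier (Hom \<C> P C)" "g' \<cdot> c = e \<cdot> p"
      using xi_projective_lift[OF P t' ep] by blast
    have hc: "h \<cdot> c \<in> carrier (Hom \<C> P E)" using cmp_closed PO TE c by blast
    \<comment> \<open>\<open>?w\<close> is the difference \<open>p - h \<cdot> c\<close>.\<close>
    let ?w = "(inv\<^bsub>Hom \<C> P E\<^esub> (h \<cdot> c)) \<otimes>\<^bsub>Hom \<C> P E\<^esub> p"
    have w: "?w \<in> carrier (Hom \<C> P E)" using hc p by simp
    have "e \<cdot> (h \<cdot> c) = e \<cdot> p"
      using cmp_assoc[OF PO TE(2,3) TF(3) c(1) TE(5) TF(5)] c eh by simp
    then have "e \<cdot> ?w = \<one>\<^bsub>Hom \<C> P F\<^esub>"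
      using PO TE TF hc p ep by (simp add: cmp_mult_right cmp_inv_right)
    then obtain u where u: "u \<in> carrier (Hom \<C> P D)" "?w = d \<cdot> u"
      using xi_projective_kernel[OF P xF w] by blast
    obtain v where v: "v \<in> carrier (Hom \<C> P B)" "f' \<cdot> v = u"
      using xi_projective_lift[OF P t u(1)] by blast
    have gv: "g \<cdot> v \<in> carrier (Hom \<C> P C)" using cmp_closed PO T' v by blast
    have "h \<cdot> (g \<cdot> v) = d \<cdot> u"
      using cmp_assoc[OF PO T'(1,2) TE(3) v(1) T'(4) TE(5)] hg v
        cmp_assoc[OF PO T(2,3) TF(2) v(1) T(5) TF(4)] by simp
    then have "h \<cdot> (c \<otimes>\<^bsub>Hom \<C> P C\<^esub> (g \<cdot> v)) = (h \<cdot> c) \<otimes>\<^bsub>Hom \<C> P E\<^esub> ?w"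
      using PO TE c gv u by (simp add: cmp_mult_right)
    also have "\<dots> = p" using hc p by (simp flip: GE.m_assoc)
    finally show "\<exists>k \<in> carrier (Hom \<C> P C). h \<cdot> k = p" using c gv by blast
  qed
  then show thesis using xF that by blast
qed

lemma xi_pullback:
  assumes t1: "(A1, x1, B1, y1, C, \<delta>1) \<in> \<xi>" and t2: "(A2, x2, B2, y2, C, \<delta>2) \<in> \<xi>"
  obtains M m1 n1 \<epsilon>1 m2 n2 \<epsilon>2 where "(A1, m1, M, n1, B2, \<epsilon>1) \<in> \<xi>" "(A2, m2, M, n2, B1, \<epsilon>2) \<in> \<xi>"
proof -
  note T1 = triangle_closed[OF xi_triangle[OF t1]] and T2 = triangle_closed[OF xi_triangle[OF t2]]
  obtain M m1 n1 m2 n2 where M: "(A1, m1, M, n1, B2, pull \<C> y2 \<delta>1) \<in> triangles \<C>"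
    "(A2, m2, M, n2, B1, pull \<C> y1 \<delta>2) \<in> triangles \<C>"
    using triangle_pullback[OF xi_triangle[OF t1] xi_triangle[OF t2]] .
  show thesis
    using that[OF base_change[OF t1 T2(2,5) M(1)] base_change[OF t2 T1(2,5) M(2)]] .
qed

lemma xi_pushout:
  assumes t1: "(A, x1, B1, y1, C1, \<delta>1) \<in> \<xi>" and t2: "(A, x2, B2, y2, C2, \<delta>2) \<in> \<xi>"
  obtains M m1 n1 \<epsilon>1 m2 n2 \<epsilon>2 where "(B1, m1, M, n1, C2, \<epsilon>1) \<in> \<xi>" "(B2, m2, M, n2, C1, \<epsilon>2) \<in> \<xi>"
proof -
  note T1 = triangle_closed[OF xi_triangle[OF t1]] and T2 = triangle_closed[OF xi_triangle[OF t2]]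
  obtain M m1 n1 m2 n2 where M: "(B1, m1, M, n1, C2, push \<C> x1 \<delta>2) \<in> triangles \<C>"
    "(B2, m2, M, n2, C1, push \<C> x2 \<delta>1) \<in> triangles \<C>"
    using triangle_pushout[OF xi_triangle[OF t1] xi_triangle[OF t2]] .
  show thesis
    using that[OF cobase_change[OF t2 T1(2,4) M(1)] cobase_change[OF t1 T2(2,4) M(2)]] .
qed

end


section \<open>Chains of triangles\<close>

text \<open>
  The triangles behind an exact complex with middle terms \<open>Xs\<close>, without the differentials, which the
  triangles determine.  With no middle term the ends must be equal rather than isomorphic, so that chains
  compose by concatenation.
\<close>

primrec xi_chain :: "('o, 'm, 'e) triangle set \<Rightarrow> 'o \<Rightarrow> 'o list \<Rightarrow> 'o \<Rightarrow> bool" where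
  "xi_chain \<xi> N [] M \<longleftrightarrow> N = M"
| "xi_chain \<xi> N (X # Xs) M \<longleftrightarrow> (\<exists>g f K \<delta>. (N, g, X, f, K, \<delta>) \<in> \<xi> \<and> xi_chain \<xi> K Xs M)"

declare xi_chain.simps(2) [simp del]
lemmas xi_chain_Cons = xi_chain.simps(2)

lemma xi_chain_append:
  "xi_chain \<xi> N (Xs @ Ys) M \<longleftrightarrow> (\<exists>K. xi_chain \<xi> N Xs K \<and> xi_chain \<xi> K Ys M)"
  by (induction Xs arbitrary: N) (simp, simp add: xi_chain_Cons, blast)

lemma xi_chain_snoc:
  "xi_chain \<xi> N (Xs @ [X]) M \<longleftrightarrow> (\<exists>K g f \<delta>. xi_chain \<xi> N Xs K \<and> (K, g, X, f, M, \<delta>) \<in> \<xi>)"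
  unfolding xi_chain_append xi_chain_Cons by auto

lemma xi_chain_iff_kernels:
  "xi_chain \<xi> N Xs M \<longleftrightarrow> (\<exists>K. K 0 = N \<and> K (length Xs) = M \<and>
     (\<forall>j<length Xs. \<exists>g f \<delta>. (K j, g, Xs ! j, f, K (Suc j), \<delta>) \<in> \<xi>))"
proof (induction Xs arbitrary: N)
  case Nil
  show ?case by auto
next
  case (Cons X Xs)
  show ?case
  proof
    assume "xi_chain \<xi> N (X # Xs) M"
    then obtain g f K \<delta> where t: "(N, g, X, f, K, \<delta>) \<in> \<xi>" and c: "xi_chain \<xi> K Xs M"
      unfolding xi_chain_Cons by blast
    obtain L where L: "L 0 = K" "L (length Xs) = M"
      "\<forall>j<length Xs. \<exists>g f \<delta>. (L j, g, Xs ! j, f, L (Suc j), \<delta>) \<in> \<xi>"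
      using c Cons.IH by blast
    show "\<exists>K. K 0 = N \<and> K (length (X # Xs)) = M \<and>
      (\<forall>j<length (X # Xs). \<exists>g f \<delta>. (K j, g, (X # Xs) ! j, f, K (Suc j), \<delta>) \<in> \<xi>)"
    proof (intro exI[of _ "case_nat N L"] conjI allI impI)
      fix j assume "j < length (X # Xs)"
      then show "\<exists>g f \<delta>. (case_nat N L j, g, (X # Xs) ! j, f, case_nat N L (Suc j), \<delta>) \<in> \<xi>"
        using t L by (cases j) auto
    qed (use L in auto)
  next
    assume "\<exists>K. K 0 = N \<and> K (length (X # Xs)) = M \<and>
      (\<forall>j<length (X # Xs). \<exists>g f \<delta>. (K j, g, (X # Xs) ! j, f, K (Suc j), \<delta>) \<in> \<xi>)"
    then obtain K where K: "K 0 = N" "K (Suc (length Xs)) = M"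
      and t: "\<And>j. j < Suc (length Xs) \<Longrightarrow> \<exists>g f \<delta>. (K j, g, (X # Xs) ! j, f, K (Suc j), \<delta>) \<in> \<xi>"
      by auto
    have "xi_chain \<xi> (K 1) Xs M"
      unfolding Cons.IH using K t[of "Suc _"] by (intro exI[of _ "\<lambda>j. K (Suc j)"]) auto
    then show "xi_chain \<xi> N (X # Xs) M" using t[of 0] K by (auto simp: xi_chain_Cons)
  qed
qed

lemma xi_exact_iff_chain:
  assumes "Xs \<noteq> []"
  shows "(\<exists>ds. xi_exact \<C> \<xi> (N # Xs @ [M]) ds) \<longleftrightarrow> xi_chain \<xi> N Xs M"
proof
  assume "\<exists>ds. xi_exact \<C> \<xi> (N # Xs @ [M]) ds"
  then obtain K f g \<delta> where "K 0 = N" "K (length Xs) = M"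
    and "\<And>j. j < length Xs \<Longrightarrow> (K j, g j, (Xs @ [M]) ! j, f j, K (j + 1), \<delta> j) \<in> \<xi>"
    using assms unfolding xi_exact_def by (auto simp: nth_append)
  then show "xi_chain \<xi> N Xs M"
    unfolding xi_chain_iff_kernels by (intro exI[of _ K]) (force simp: nth_append)
next
  let ?n = "length Xs"
  assume "xi_chain \<xi> N Xs M"
  then obtain K where K: "K 0 = N" "K ?n = M"
    and "\<forall>j<?n. \<exists>g f \<delta>. (K j, g, Xs ! j, f, K (Suc j), \<delta>) \<in> \<xi>"
    unfolding xi_chain_iff_kernels by blast
  then obtain g f \<delta> where t: "\<forall>j<?n. (K j, g j, Xs ! j, f j, K (Suc j), \<delta> j) \<in> \<xi>"
    by metis
  let ?ds = "g 0 # map (\<lambda>j. g (Suc j) \<cdot>\<^bsub>\<C>\<^esub> f j) [0..<?n - 1] @ [f (?n - 1)]"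
  have "xi_exact \<C> \<xi> (N # Xs @ [M]) ?ds"
    unfolding xi_exact_def
  proof (intro exI[of _ ?n] conjI)
    show "length (N # Xs @ [M]) = ?n + 2" "length ?ds = ?n + 1" using assms by (auto simp: Suc_leI)
    show "if ?n = 0 then is_iso \<C> ((N # Xs @ [M]) ! 0) ((N # Xs @ [M]) ! 1) (?ds ! 0)
      else \<exists>K f g \<delta>. K 0 = (N # Xs @ [M]) ! 0 \<and> K ?n = (N # Xs @ [M]) ! (?n + 1) \<and>
       (\<forall>j<?n. (K j, g j, (N # Xs @ [M]) ! (j + 1), f j, K (j + 1), \<delta> j) \<in> \<xi>) \<and>
       ?ds ! 0 = g 0 \<and> (\<forall>j. j + 1 < ?n \<longrightarrow> ?ds ! (j + 1) = g (j + 1) \<cdot>\<^bsub>\<C>\<^esub> f j) \<and> ?ds ! ?n = f (?n - 1)"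
    proof -
      have "(N # Xs @ [M]) ! (?n + 1) = M" by (simp add: nth_append)
      moreover have "(K j, g j, (N # Xs @ [M]) ! (j + 1), f j, K (j + 1), \<delta> j) \<in> \<xi>" if "j < ?n" for j
        using t that by (simp add: nth_append)
      moreover have "?ds ! (j + 1) = g (j + 1) \<cdot>\<^bsub>\<C>\<^esub> f j" if "j + 1 < ?n" for j
      proof -
        have "j < ?n - 1" using that by simp
        then show ?thesis by (simp add: nth_append)
      qed
      moreover have "?ds ! ?n = f (?n - 1)" using assms by (cases ?n) (auto simp: nth_append)
      ultimately show ?thesis
        using assms K
        by (simp only: if_False length_0_conv)
          (rule exI[of _ K], rule exI[of _ f], rule exI[of _ g], rule exI[of _ \<delta>], simp)
    qed
  qed
  then show "\<exists>ds. xi_exact \<C> \<xi> (N # Xs @ [M]) ds" by blast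
qed

lemma (in ex_category) xi_exact_id: "A \<in> Obj \<C> \<Longrightarrow> xi_exact \<C> \<xi> [A, A] [Id \<C> A]"
  using Id_closed[of A] cmp_Id_left[of A A "Id \<C> A"]
  by (simp add: xi_exact_def is_iso_def) blast


section \<open>Quasi-resolving subcategories\<close>

locale quasi_resolving_subcategory = proper_extriangulated \<C> \<xi>
  for \<C> :: "('o, 'm, 'e) extri" (structure) and \<xi> :: "('o, 'm, 'e) triangle set" +
  fixes \<X> :: "'o set"
  assumes enough: "enough_projectives \<C> \<xi>"
    and quasi_resolving: "quasi_resolving \<C> \<xi> \<X>"
begin

lemma quasi_resolving_triangle:
  assumes "(A, x, B, y, C, \<delta>) \<in> \<xi>"
  shows extension_closed: "\<lbrakk>A \<in> \<X>; C \<in> \<X>\<rbrakk> \<Longrightarrow> B \<in> \<X>"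
    and cocone_closed: "\<lbrakk>B \<in> \<X>; C \<in> \<X>\<rbrakk> \<Longrightarrow> A \<in> \<X>"
proof -
  have "\<forall>(A, x, B, y, C, \<delta>) \<in> \<xi>. (A \<in> \<X> \<and> C \<in> \<X> \<longrightarrow> B \<in> \<X>) \<and> (B \<in> \<X> \<and> C \<in> \<X> \<longrightarrow> A \<in> \<X>)"
    using quasi_resolving unfolding quasi_resolving_def by (elim conjE)
  from bspec[OF this assms] show "\<lbrakk>A \<in> \<X>; C \<in> \<X>\<rbrakk> \<Longrightarrow> B \<in> \<X>" "\<lbrakk>B \<in> \<X>; C \<in> \<X>\<rbrakk> \<Longrightarrow> A \<in> \<X>"
    by simp_all
qed

lemma projective_cover:
  assumes X: "X \<in> \<X>"
  obtains X' u P p \<delta> where "(X', u, P, p, X, \<delta>) \<in> \<xi>" "P \<in> projectives_in \<C> \<xi> \<X>" "X' \<in> \<X>"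
proof -
  have "X \<in> res \<C> \<xi> (projectives_in \<C> \<xi> \<X>)"
    using X quasi_resolving unfolding quasi_resolving_def by blast
  then obtain P d where "xi_exact_left \<C> \<xi> P d X" and P: "\<forall>i. P i \<in> projectives_in \<C> \<xi> \<X>"
    unfolding res_def by blast
  then obtain K f g \<delta> where "K (0::nat) = X" "\<forall>i. (K (i + 1), g i, P i, f i, K i, \<delta> i) \<in> \<xi>"
    unfolding xi_exact_left_def by auto
  then have t: "(K 1, g 0, P 0, f 0, X, \<delta> 0) \<in> \<xi>" by (metis add_0)
  then have "K 1 \<in> \<X>" using cocone_closed X P unfolding projectives_in_def by blast
  then show thesis using t P that by blast
qed

text \<open>
  By induction from the right: P replaces Y and is split off, V, the fibre product of W and E over L,
  replaces W, and the induction hypothesis applies to the remaining complex with last term V and end E.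
\<close>

lemma chain_with_projective_tail:
  assumes "xi_chain \<xi> N (Xs @ [Y]) M" "set Xs \<subseteq> \<X>" "Y \<in> \<X>"
  shows "\<exists>X Ps. X \<in> \<X> \<and> length Ps = length Xs \<and> set Ps \<subseteq> projectives_in \<C> \<xi> \<X> \<and>
    xi_chain \<xi> N (X # Ps) M"
  using assms
proof (induction Xs arbitrary: Y M rule: rev_induct)
  case Nil
  then show ?case by (intro exI[of _ Y] exI[of _ "[]"]) auto
next
  case (snoc W Xs)
  obtain K g f \<gamma> L g' f' \<gamma>' where c: "xi_chain \<xi> N Xs K"
    and tW: "(K, g, W, f, L, \<gamma>) \<in> \<xi>" and tY: "(L, g', Y, f', M, \<gamma>') \<in> \<xi>"
    using snoc.prems(1) unfolding xi_chain_snoc by blast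
  obtain Y' u P p \<delta> where P: "(Y', u, P, p, Y, \<delta>) \<in> \<xi>" "P \<in> projectives_in \<C> \<xi> \<X>" "Y' \<in> \<X>"
    using projective_cover[OF snoc.prems(3)] .
  obtain E h e d \<epsilon> \<eta> where E: "(E, h, P, f' \<cdot> p, M, \<epsilon>) \<in> \<xi>" "(Y', e, E, d, L, \<eta>) \<in> \<xi>"
    using xi_deflation_compose[OF tY P(1)] .
  obtain V m1 n1 \<epsilon>1 m2 n2 \<epsilon>2 where V: "(Y', m1, V, n1, W, \<epsilon>1) \<in> \<xi>" "(K, m2, V, n2, E, \<epsilon>2) \<in> \<xi>"
    using xi_pullback[OF E(2) tW] .
  have "V \<in> \<X>" using extension_closed[OF V(1)] P snoc.prems(2) by simp
  moreover have "xi_chain \<xi> N (Xs @ [V]) E" using c V(2) unfolding xi_chain_snoc by blast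
  ultimately obtain X Ps where "X \<in> \<X>" "length Ps = length Xs" "set Ps \<subseteq> projectives_in \<C> \<xi> \<X>"
    "xi_chain \<xi> N (X # Ps) E"
    using snoc.IH[of V E] snoc.prems(2) by auto
  moreover from this have "xi_chain \<xi> N (X # Ps @ [P]) M"
    using E(1) xi_chain_snoc[of \<xi> N "X # Ps" P M] by auto
  ultimately show ?case
    using P(2) by (intro exI[of _ X] exI[of _ "Ps @ [P]"]) simp
qed

text \<open>
  Once all terms but the first, Y, are projective, a resolution \<open>Y' \<rightarrow> P \<rightarrow> Y\<close> replaces Y by P at the cost of
  replacing N by the kernel of the composite from P, which is an extension of N by \<open>Y'\<close>.
\<close>

lemma chain_with_projectives:
  assumes c: "xi_chain \<xi> N Xs M" and X: "set Xs \<subseteq> \<X>" "Xs \<noteq> []"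
  shows "\<exists>L Ps X x y \<delta>. length Ps = length Xs \<and> set Ps \<subseteq> projectives_in \<C> \<xi> \<X> \<and>
    xi_chain \<xi> L Ps M \<and> X \<in> \<X> \<and> (X, x, L, y, N, \<delta>) \<in> \<xi>"
proof -
  obtain Ws W where Xs: "Xs = Ws @ [W]" using X(2) by (cases Xs rule: rev_cases) auto
  obtain Y Ps where Y: "Y \<in> \<X>" and Ps: "length Ps = length Ws" "set Ps \<subseteq> projectives_in \<C> \<xi> \<X>"
    and c': "xi_chain \<xi> N (Y # Ps) M"
    using chain_with_projective_tail[of N Ws W M] c X unfolding Xs by auto
  obtain g f K \<gamma> where tY: "(N, g, Y, f, K, \<gamma>) \<in> \<xi>" and cK: "xi_chain \<xi> K Ps M"
    using c' unfolding xi_chain_Cons by blast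
  obtain Y' u P p \<delta> where P: "(Y', u, P, p, Y, \<delta>) \<in> \<xi>" "P \<in> projectives_in \<C> \<xi> \<X>" "Y' \<in> \<X>"
    using projective_cover[OF Y] .
  obtain E h e d \<epsilon> \<eta> where E: "(E, h, P, f \<cdot> p, K, \<epsilon>) \<in> \<xi>" "(Y', e, E, d, N, \<eta>) \<in> \<xi>"
    using xi_deflation_compose[OF tY P(1)] .
  have "xi_chain \<xi> E (P # Ps) M" using E(1) cK unfolding xi_chain_Cons by blast
  then show ?thesis
    using P E(2) Ps Xs by (intro exI[of _ E] exI[of _ "P # Ps"] exI[of _ Y']) auto
qed

text \<open>
  Pull the last triangle back along a projective resolution of M.
\<close>

lemma chain_with_projective_end:
  assumes c: "xi_chain \<xi> N (Xs @ [Y]) M" and X: "Y \<in> \<X>" "M \<in> \<X>"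
  shows "\<exists>V P. V \<in> \<X> \<and> P \<in> projectives_in \<C> \<xi> \<X> \<and> xi_chain \<xi> N (Xs @ [V]) P"
proof -
  obtain K g f \<gamma> where c: "xi_chain \<xi> N Xs K" and tY: "(K, g, Y, f, M, \<gamma>) \<in> \<xi>"
    using assms(1) unfolding xi_chain_snoc by blast
  obtain M' u P p \<delta> where P: "(M', u, P, p, M, \<delta>) \<in> \<xi>" "P \<in> projectives_in \<C> \<xi> \<X>" "M' \<in> \<X>"
    using projective_cover[OF X(2)] .
  obtain V m1 n1 \<epsilon>1 m2 n2 \<epsilon>2 where V: "(M', m1, V, n1, Y, \<epsilon>1) \<in> \<xi>" "(K, m2, V, n2, P, \<epsilon>2) \<in> \<xi>"
    using xi_pullback[OF P(1) tY] .
  have "V \<in> \<X>" using extension_closed[OF V(1)] P X by simp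
  then show ?thesis
    using c V(2) P(2) unfolding xi_chain_snoc by blast
qed

text \<open>
  By induction from the left, dually to \<open>chain_with_projective_tail\<close>.
\<close>

lemma chain_with_cogenerator_head:
  assumes H: "xi_cogenerator \<C> \<xi> \<H> \<X>"
    and "xi_chain \<xi> N (Y # Xs) M" "set Xs \<subseteq> \<X>" "Y \<in> \<X>"
  shows "\<exists>Hs X. X \<in> \<X> \<and> length Hs = length Xs \<and> set Hs \<subseteq> \<H> \<and> xi_chain \<xi> N (Hs @ [X]) M"
  using assms(2-)
proof (induction Xs arbitrary: N Y)
  case Nil
  then show ?case by (intro exI[of _ "[]"] exI[of _ Y]) auto
next
  case (Cons W Xs)
  obtain g f K \<gamma> g' f' L \<gamma>' where tY: "(N, g, Y, f, K, \<gamma>) \<in> \<xi>"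
    and tW: "(K, g', W, f', L, \<gamma>') \<in> \<xi>" and c: "xi_chain \<xi> L Xs M"
    using Cons.prems(1) unfolding xi_chain_Cons by blast
  obtain x T y Y' \<delta> where T: "(Y, x, T, y, Y', \<delta>) \<in> \<xi>" "T \<in> \<H>" "Y' \<in> \<X>"
    using H Cons.prems(3) unfolding xi_cogenerator_def by blast
  obtain E h d e \<epsilon> \<eta> where E: "(N, x \<cdot> g, T, h, E, \<epsilon>) \<in> \<xi>" "(K, d, E, e, Y', \<eta>) \<in> \<xi>"
    using xi_inflation_compose[OF enough tY T(1)] .
  obtain V m1 n1 \<epsilon>1 m2 n2 \<epsilon>2 where V: "(W, m1, V, n1, Y', \<epsilon>1) \<in> \<xi>" "(E, m2, V, n2, L, \<epsilon>2) \<in> \<xi>"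
    using xi_pushout[OF tW E(2)] .
  have "V \<in> \<X>" using extension_closed[OF V(1)] T Cons.prems(2) by simp
  moreover have "xi_chain \<xi> E (V # Xs) M" using c V(2) unfolding xi_chain_Cons by blast
  ultimately obtain Hs X where "X \<in> \<X>" "length Hs = length Xs" "set Hs \<subseteq> \<H>"
    "xi_chain \<xi> E (Hs @ [X]) M"
    using Cons.IH[of E V] Cons.prems(2) by auto
  moreover from this have "xi_chain \<xi> N ((T # Hs) @ [X]) M" using E(1) by (auto simp: xi_chain_Cons)
  ultimately show ?case
    using T(2) by (intro exI[of _ "T # Hs"] exI[of _ X]) simp
qed

text \<open>
  Push the first triangle out along the embedding of N into an object of the cogenerator.
\<close>

lemma chain_with_cogenerator_start:
  assumes H: "xi_cogenerator \<C> \<xi> \<H> \<X>"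
    and c: "xi_chain \<xi> N (Y # Xs) M" and X: "N \<in> \<X>" "Y \<in> \<X>"
  shows "\<exists>T V. T \<in> \<H> \<and> V \<in> \<X> \<and> xi_chain \<xi> T (V # Xs) M"
proof -
  obtain g f K \<gamma> where tY: "(N, g, Y, f, K, \<gamma>) \<in> \<xi>" and cK: "xi_chain \<xi> K Xs M"
    using c unfolding xi_chain_Cons by blast
  obtain x T y N' \<delta> where T: "(N, x, T, y, N', \<delta>) \<in> \<xi>" "T \<in> \<H>" "N' \<in> \<X>"
    using H X(1) unfolding xi_cogenerator_def by blast
  obtain V m1 n1 \<epsilon>1 m2 n2 \<epsilon>2 where V: "(Y, m1, V, n1, N', \<epsilon>1) \<in> \<xi>" "(T, m2, V, n2, K, \<epsilon>2) \<in> \<xi>"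
    using xi_pushout[OF tY T(1)] .
  have "V \<in> \<X>" using extension_closed[OF V(1)] T X by simp
  then show ?thesis using V(2) cK T(2) unfolding xi_chain_Cons by blast
qed

text \<open>
  Cut the complex so that m terms and the future X lie to the right of the cut.  Making the terms on the
  right projective leaves one term W of the subcategory at the cut; it joins the left part, whose terms are
  then moved into the cogenerator, until X is left over at the cut.
\<close>

lemma chain_mixed:
  assumes H: "xi_cogenerator \<C> \<xi> \<H> \<X>"
    and c: "xi_chain \<xi> N Xs M" and X: "set Xs \<subseteq> \<X>" and m: "m < length Xs"
  shows "\<exists>Hs X Ps. length Hs = length Xs - 1 - m \<and> set Hs \<subseteq> \<H> \<and> X \<in> \<X> \<and>
    length Ps = m \<and> set Ps \<subseteq> projectives_in \<C> \<xi> \<X> \<and> xi_chain \<xi> N (Hs @ [X] @ Ps) M"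
proof -
  obtain Ys Y where Xs: "Xs = Ys @ [Y]" using m by (cases Xs rule: rev_cases) auto
  define k where "k = length Ys - m"
  define As where "As = take k Ys"
  define Bs where "Bs = drop k Ys"
  have Ys: "Ys = As @ Bs" and lA: "length As = length Xs - 1 - m" and lB: "length Bs = m"
    using m Xs by (auto simp: As_def Bs_def k_def)
  have S: "set As \<subseteq> \<X>" "set Bs \<subseteq> \<X>" "Y \<in> \<X>" using X Xs Ys by auto
  obtain K where K: "xi_chain \<xi> N As K" "xi_chain \<xi> K (Bs @ [Y]) M"
    using c Xs Ys xi_chain_append[of \<xi> N As "Bs @ [Y]" M] by auto
  obtain W Ps where W: "W \<in> \<X>" "length Ps = m" "set Ps \<subseteq> projectives_in \<C> \<xi> \<X>"
    "xi_chain \<xi> K (W # Ps) M"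
    using chain_with_projective_tail[OF K(2) S(2,3)] lB by auto
  obtain L where L: "xi_chain \<xi> N (As @ [W]) L" "xi_chain \<xi> L Ps M"
    using W(4) K(1) unfolding xi_chain_snoc xi_chain_Cons by blast
  obtain Zs Z where Z: "As @ [W] = Z # Zs" by (cases "As @ [W]") auto
  then have "set (Z # Zs) \<subseteq> \<X>" using S(1) W(1) by (simp flip: Z)
  moreover have lZ: "length Zs = length As" using arg_cong[OF Z, of length] by simp
  ultimately obtain Hs X where "X \<in> \<X>" "length Hs = length As" "set Hs \<subseteq> \<H>"
    "xi_chain \<xi> N (Hs @ [X]) L"
    using chain_with_cogenerator_head[OF H, of N Z Zs L] L(1) Z by auto
  moreover from this have "xi_chain \<xi> N (Hs @ [X] @ Ps) M"
    using L(2) xi_chain_append[of \<xi> N "Hs @ [X]" Ps M] by auto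
  ultimately show ?thesis using W lA by auto
qed

end


section \<open>Exchanging the terms of an exact complex\<close>

theorem theorem3p6:
  fixes \<C> :: "('o, 'm, 'e) extri"
    and \<xi> :: "('o, 'm, 'e) triangle set"
    and \<X> :: "'o set"
    and n :: nat
    and N M :: 'o
    and Xs :: "'o list"
    and ds :: "'m list"
  assumes "extriangulated_category \<C>"
    and "WIC \<C>"
    and "proper_class \<C> \<xi>"
    and "enough_projectives \<C> \<xi>"
    and "enough_injectives \<C> \<xi>"
    and "quasi_resolving \<C> \<xi> \<X>"
    and "length Xs = n" and "set Xs \<subseteq> \<X>"
    and "xi_exact \<C> \<xi> ([N] @ Xs @ [M]) ds"
  shows
    "(n \<ge> 1 \<longrightarrow>
        (\<exists>X Ps es. X \<in> \<X> \<and> length Ps = n - 1 \<and> set Ps \<subseteq> projectives_in \<C> \<xi> \<X> \<and>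
           xi_exact \<C> \<xi> ([N, X] @ Ps @ [M]) es)) \<and>
     (\<exists>L Ps es X x y \<delta>. length Ps = n \<and> set Ps \<subseteq> projectives_in \<C> \<xi> \<X> \<and>
        xi_exact \<C> \<xi> ([L] @ Ps @ [M]) es \<and> X \<in> \<X> \<and> (X, x, L, y, N, \<delta>) \<in> \<xi>) \<and>
     (n \<ge> 1 \<and> M \<in> \<X> \<longrightarrow>
        (\<exists>X Ps es. X \<in> \<X> \<and> length Ps = n - 1 \<and> set Ps \<subseteq> projectives_in \<C> \<xi> \<X> \<and>
           xi_exact \<C> \<xi> ([N, X] @ Ps) es)) \<and>
     (M \<in> \<X> \<longrightarrow>
        (\<exists>T Ps es X x y \<delta>. length Ps = n + 1 \<and> set Ps \<subseteq> projectives_in \<C> \<xi> \<X> \<and>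
           xi_exact \<C> \<xi> ([T] @ Ps) es \<and> X \<in> \<X> \<and> (X, x, T, y, N, \<delta>) \<in> \<xi>)) \<and>
     (\<forall>\<H>. xi_cogenerator \<C> \<xi> \<H> \<X> \<longrightarrow>
        (\<forall>m<n. \<exists>Hs X Ps es. length Hs = n - 1 - m \<and> set Hs \<subseteq> \<H> \<and> X \<in> \<X> \<and>
           length Ps = m \<and> set Ps \<subseteq> projectives_in \<C> \<xi> \<X> \<and>
           xi_exact \<C> \<xi> ([N] @ Hs @ [X] @ Ps @ [M]) es)) \<and>
     (\<forall>\<H>. xi_cogenerator \<C> \<xi> \<H> \<X> \<and> N \<in> \<X> \<longrightarrow>
        (\<forall>m<n. \<exists>Hs X Ps es. length Hs = n - m \<and> set Hs \<subseteq> \<H> \<and> X \<in> \<X> \<and>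
           length Ps = m \<and> set Ps \<subseteq> projectives_in \<C> \<xi> \<X> \<and>
           xi_exact \<C> \<xi> (Hs @ [X] @ Ps @ [M]) es))"
    (is "?s1 \<and> ?s2 \<and> ?s3 \<and> ?s4 \<and> ?s5 \<and> ?s6")
proof -
  interpret extriangulated_category \<C> by fact
  interpret proper_class \<C> \<xi> by fact
  interpret quasi_resolving_subcategory \<C> \<xi> \<X>
    using assms by unfold_locales
  have chain: "xi_chain \<xi> N Xs M" if "n \<ge> 1"
  proof -
    have "Xs \<noteq> []" using assms(7) that by auto
    moreover have "xi_exact \<C> \<xi> (N # Xs @ [M]) ds" using assms(9) by simp
    ultimately show ?thesis using xi_exact_iff_chain[of Xs \<C> \<xi> N M] by blast
  qed
  have iso: "is_iso \<C> N M (ds ! 0)" if "n = 0"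
  proof -
    have "Xs = []" using assms(7) that by simp
    then have "xi_exact \<C> \<xi> [N, M] ds" using assms(9) by simp
    then show ?thesis unfolding xi_exact_def by force
  qed
  have exact: "\<exists>es. xi_exact \<C> \<xi> (A # Ys @ [B]) es" if "xi_chain \<xi> A Ys B" "length Ys \<ge> 1" for A Ys B
  proof -
    have "Ys \<noteq> []" using that(2) by auto
    from xi_exact_iff_chain[OF this, of \<C> \<xi> A B] that(1) show ?thesis by (rule iffD2)
  qed
  have last: "\<exists>Ys Y. Xs = Ys @ [Y] \<and> length Ys = n - 1 \<and> set Ys \<subseteq> \<X> \<and> Y \<in> \<X>" if "n \<ge> 1"
    using assms(7,8) that by (cases Xs rule: rev_cases) auto
  have ?s1
  proof
    assume n: "n \<ge> 1"
    obtain X Ps where "X \<in> \<X>" "length Ps = n - 1" "set Ps \<subseteq> projectives_in \<C> \<xi> \<X>"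
      "xi_chain \<xi> N (X # Ps) M"
    proof -
      obtain Ys Y where Ys: "Xs = Ys @ [Y]" "length Ys = n - 1" "set Ys \<subseteq> \<X>" "Y \<in> \<X>"
        using last[OF n] by blast
      show thesis
        using chain_with_projective_tail[of N Ys Y M] chain[OF n] Ys that by auto
    qed
    then show "\<exists>X Ps es. X \<in> \<X> \<and> length Ps = n - 1 \<and> set Ps \<subseteq> projectives_in \<C> \<xi> \<X> \<and>
       xi_exact \<C> \<xi> ([N, X] @ Ps @ [M]) es"
      using exact[of N "X # Ps" M] by auto
  qed
  moreover have ?s2
  proof (cases "n = 0")
    \<comment> \<open>The given isomorphism is the complex, and a split triangle \<open>0 \<rightarrow> N \<rightarrow> N\<close> goes with it.\<close>
    case True
    obtain Z where Z: "Z \<in> \<X>" "is_zero_object \<C> Z"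
      using quasi_resolving unfolding quasi_resolving_def additive_subcategory_def by blast
    have N: "N \<in> Obj \<C>" using iso[OF True] unfolding is_iso_def by simp
    have "(Z, \<one>\<^bsub>Hom \<C> Z N\<^esub>, N, Id \<C> N, N, \<one>\<^bsub>Ext \<C> N Z\<^esub>) \<in> \<xi>"
      using split_in realize_zero biproduct_with_zero[OF Z(2) N] by blast
    moreover have "xi_exact \<C> \<xi> ([N] @ [] @ [M]) ds" using assms(7,9) True by simp
    ultimately show ?thesis using True Z(1) by (metis empty_set empty_subsetI list.size(3))
  next
    case False
    then have n: "n \<ge> 1" by simp
    obtain L Ps X x y \<delta> where "length Ps = n" "set Ps \<subseteq> projectives_in \<C> \<xi> \<X>"
      "xi_chain \<xi> L Ps M" "X \<in> \<X>" "(X, x, L, y, N, \<delta>) \<in> \<xi>"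
      using chain_with_projectives[OF chain[OF n] assms(8)] assms(7) n by fastforce
    moreover from this obtain es where "xi_exact \<C> \<xi> ([L] @ Ps @ [M]) es"
      using exact[of L Ps M] n by auto
    ultimately show ?thesis by blast
  qed
  moreover have ?s3
  proof (intro impI)
    assume "n \<ge> 1 \<and> M \<in> \<X>"
    then have n: "n \<ge> 1" and M: "M \<in> \<X>" by auto
    obtain Ys Y where Ys: "Xs = Ys @ [Y]" "length Ys = n - 1" "set Ys \<subseteq> \<X>" "Y \<in> \<X>"
      using last[OF n] by blast
    obtain K g f \<gamma> where cK: "xi_chain \<xi> N Ys K" and t: "(K, g, Y, f, M, \<gamma>) \<in> \<xi>"
      using chain[OF n] unfolding Ys(1) xi_chain_snoc by blast
    have K: "K \<in> \<X>" using cocone_closed[OF t] Ys M by simp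
    show "\<exists>X Ps es. X \<in> \<X> \<and> length Ps = n - 1 \<and> set Ps \<subseteq> projectives_in \<C> \<xi> \<X> \<and>
       xi_exact \<C> \<xi> ([N, X] @ Ps) es"
    proof (cases Ys rule: rev_cases)
      \<comment> \<open>Here \<open>n = 1\<close>: N itself lies in the subcategory, and the complex is its identity.\<close>
      case Nil
      then have "N \<in> \<X>" using cK K by simp
      moreover have "N \<in> Obj \<C>" using Nil cK triangle_closed(1)[OF xi_triangle[OF t]] by simp
      then have "xi_exact \<C> \<xi> ([N, N] @ []) [Id \<C> N]" using xi_exact_id by simp
      ultimately show ?thesis using Nil Ys(2) by (intro exI[of _ N] exI[of _ "[]"] exI[of _ "[Id \<C> N]"]) auto
    next
      \<comment> \<open>K takes over from M, which saves one term, and is then replaced by a projective.\<close>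
      case (snoc Ws W)
      obtain V P where V: "V \<in> \<X>" and P: "P \<in> projectives_in \<C> \<xi> \<X>" "xi_chain \<xi> N (Ws @ [V]) P"
        using chain_with_projective_end[of N Ws W K] cK K Ys(3) snoc by auto
      obtain X Ps where X: "X \<in> \<X>" "length Ps = length Ws" "set Ps \<subseteq> projectives_in \<C> \<xi> \<X>"
        "xi_chain \<xi> N (X # Ps) P"
        using chain_with_projective_tail[OF P(2) _ V] Ys(3) snoc by auto
      then obtain es where "xi_exact \<C> \<xi> ([N, X] @ Ps @ [P]) es"
        using exact[of N "X # Ps" P] by auto
      then show ?thesis using X P snoc Ys(2) by (intro exI[of _ X] exI[of _ "Ps @ [P]"] exI[of _ es]) auto
    qed
  qed
  moreover have ?s4
  proof
    assume M: "M \<in> \<X>"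
    show "\<exists>T Ps es X x y \<delta>. length Ps = n + 1 \<and> set Ps \<subseteq> projectives_in \<C> \<xi> \<X> \<and>
       xi_exact \<C> \<xi> ([T] @ Ps) es \<and> X \<in> \<X> \<and> (X, x, T, y, N, \<delta>) \<in> \<xi>"
    proof (cases "n = 0")
      \<comment> \<open>N is isomorphic to M, and a resolution of M is transported to N.\<close>
      case True
      obtain M' u P p \<delta> where P: "(M', u, P, p, M, \<delta>) \<in> \<xi>" "P \<in> projectives_in \<C> \<xi> \<X>" "M' \<in> \<X>"
        using projective_cover[OF M] .
      note T = triangle_closed[OF xi_triangle[OF P(1)]]
      obtain j where N: "N \<in> Obj \<C>" and i: "ds ! 0 \<in> carrier (Hom \<C> N M)"
        and j: "j \<in> carrier (Hom \<C> M N)" "ds ! 0 \<cdot>\<^bsub>\<C>\<^esub> j = Id \<C> M" "j \<cdot>\<^bsub>\<C>\<^esub> ds ! 0 = Id \<C> N"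
        using iso[OF True] unfolding is_iso_def by blast
      let ?\<epsilon> = "pull \<C> (ds ! 0) \<delta>"
      have "push \<C> (Id \<C> M') ?\<epsilon> = ?\<epsilon>"
        using push_Id[OF T(1) N pull_closed[OF T(1,3) N i T(6)]] .
      then have "(M', u \<cdot>\<^bsub>\<C>\<^esub> Id \<C> M', P, j \<cdot>\<^bsub>\<C>\<^esub> p, N, ?\<epsilon>) \<in> triangles \<C>"
        using triangle_transport[OF xi_triangle[OF P(1)] T(1) N Id_closed[OF T(1)] Id_closed[OF T(1)]
            _ _ j(1) i j(2,3)] cmp_Id_left[OF T(1,1) Id_closed[OF T(1)]] by simp
      then have "(M', u \<cdot>\<^bsub>\<C>\<^esub> Id \<C> M', P, j \<cdot>\<^bsub>\<C>\<^esub> p, N, ?\<epsilon>) \<in> \<xi>"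
        using base_change[OF P(1) N i] by blast
      moreover have "xi_exact \<C> \<xi> ([P] @ [P]) [Id \<C> P]" using xi_exact_id T(2) by simp
      ultimately show ?thesis
        using P True by (intro exI[of _ P] exI[of _ "[P]"] exI[of _ "[Id \<C> P]"] exI[of _ M']) auto
    next
      case False
      then have n: "n \<ge> 1" by simp
      obtain Ys Y where Ys: "Xs = Ys @ [Y]" "length Ys = n - 1" "set Ys \<subseteq> \<X>" "Y \<in> \<X>"
        using last[OF n] by blast
      obtain V P where V: "V \<in> \<X>" and P: "P \<in> projectives_in \<C> \<xi> \<X>" "xi_chain \<xi> N (Ys @ [V]) P"
        using chain_with_projective_end[of N Ys Y M] chain[OF n] Ys M by auto
      obtain T Ps X x y \<delta> where T: "length Ps = n" "set Ps \<subseteq> projectives_in \<C> \<xi> \<X>"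
        "xi_chain \<xi> T Ps P" "X \<in> \<X>" "(X, x, T, y, N, \<delta>) \<in> \<xi>"
        using chain_with_projectives[OF P(2)] V Ys n by fastforce
      moreover obtain es where "xi_exact \<C> \<xi> ([T] @ Ps @ [P]) es"
        using exact[of T Ps P] T n by auto
      ultimately show ?thesis
        using P(1) by (intro exI[of _ T] exI[of _ "Ps @ [P]"] exI[of _ es] exI[of _ X]) auto
    qed
  qed
  moreover have ?s5
  proof (intro allI impI)
    fix \<H> m assume H: "xi_cogenerator \<C> \<xi> \<H> \<X>" and m: "m < n"
    then obtain Hs X Ps where H: "length Hs = n - 1 - m" "set Hs \<subseteq> \<H>" "X \<in> \<X>"
      "length Ps = m" "set Ps \<subseteq> projectives_in \<C> \<xi> \<X>" "xi_chain \<xi> N (Hs @ [X] @ Ps) M"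
      using chain_mixed[OF H chain assms(8), of m] assms(7) by auto
    moreover obtain es where "xi_exact \<C> \<xi> ([N] @ Hs @ [X] @ Ps @ [M]) es"
      using exact[OF H(6)] by auto
    ultimately show "\<exists>Hs X Ps es. length Hs = n - 1 - m \<and> set Hs \<subseteq> \<H> \<and> X \<in> \<X> \<and>
       length Ps = m \<and> set Ps \<subseteq> projectives_in \<C> \<xi> \<X> \<and>
       xi_exact \<C> \<xi> ([N] @ Hs @ [X] @ Ps @ [M]) es" by blast
  qed
  moreover have ?s6
  proof (intro allI impI)
    fix \<H> m assume "xi_cogenerator \<C> \<xi> \<H> \<X> \<and> N \<in> \<X>" and m: "m < n"
    then have H: "xi_cogenerator \<C> \<xi> \<H> \<X>" and N: "N \<in> \<X>" and n: "n \<ge> 1" by auto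
    obtain Y Ys where Ys: "Xs = Y # Ys" using assms(7) n by (cases Xs) auto
    obtain T V where T: "T \<in> \<H>" and V: "V \<in> \<X>" "xi_chain \<xi> T (V # Ys) M"
      using chain_with_cogenerator_start[OF H _ N] chain[OF n] Ys assms(8) by force
    obtain Hs X Ps where H: "length Hs = n - 1 - m" "set Hs \<subseteq> \<H>" "X \<in> \<X>"
      "length Ps = m" "set Ps \<subseteq> projectives_in \<C> \<xi> \<X>" "xi_chain \<xi> T (Hs @ [X] @ Ps) M"
      using chain_mixed[OF H V(2), of m] V(1) Ys assms(7,8) m by auto
    moreover obtain es where "xi_exact \<C> \<xi> ((T # Hs) @ [X] @ Ps @ [M]) es"
      using exact[OF H(6)] by auto
    ultimately show "\<exists>Hs X Ps es. length Hs = n - m \<and> set Hs \<subseteq> \<H> \<and> X \<in> \<X> \<and>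
       length Ps = m \<and> set Ps \<subseteq> projectives_in \<C> \<xi> \<X> \<and>
       xi_exact \<C> \<xi> (Hs @ [X] @ Ps @ [M]) es"
      using T m by (intro exI[of _ "T # Hs"] exI[of _ X] exI[of _ Ps] exI[of _ es]) auto
  qed
  ultimately show ?thesis by blast
qed

end
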